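(* Let $\Omega\subset\mathbb{R}^n$ be a domain, $1<p<\infty$, and for $h=1,\dots,n$ let $\mathscr{A}^h(x)=\{a^h_{ij}(x)\}_{i,j=1}^m$ be a matrix of real-valued locally integrable functions on $\Omega$ with $\mathscr{A}^h=(\mathscr{A}^h)^t$ and $\mathscr{A}^h\geq0$. The operator $Au=\sum_{h=1}^n\partial_h(\mathscr{A}^h(x)\partial_hu)$ is $L^p$-dissipative if and only if $$\left(\frac12-\frac1p\right)^2(\mu_1^h(x)+\mu_m^h(x))^2\leq\mu_1^h(x)\,\mu_m^h(x)$$ for almost every $x\in\Omega$ and $h=1,\dots,n$, where $\mu_1^h(x)$ and $\mu_m^h(x)$ are the smallest and the largest eigenvalues of the matrix $\mathscr{A}^h(x)$, respectively. In the particular case $m=2$ this condition is equivalent to $$\left(\frac12-\frac1p\right)^2(\mathrm{tr}\,\mathscr{A}^h(x))^2\leq\det\mathscr{A}^h(x)$$ for almost every $x\in\Omega$, $h=1,\dots,n$.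
   Context: $\mathscr{A}^h\geq0$ means $\langle\mathscr{A}^h(x)\xi,\xi\rangle\ge0$ for almost every $x\in\Omega$ and any $\xi\in\mathbb{R}^m$. $\langle\cdot,\cdot\rangle$ is the standard Hermitian scalar product in $\mathbb{C}^m$ and $\partial_h=\partial/\partial x_h$. $(C_0^1(\Omega))^m$ is the space of $C^1$ functions $\Omega\to\mathbb{C}^m$ with compact support in $\Omega$. The sesquilinear form of $A$ is $\mathscr{L}(u,v)=\int_\Omega\sum_{h=1}^n\langle\mathscr{A}^h(x)\partial_hu,\partial_hv\rangle\,dx$ for $u,v\in(C_0^1(\Omega))^m$. With $p'=p/(p-1)$, $A$ is called $L^p$-dissipative if for all $u\in(C_0^1(\Omega))^m$: $\mathrm{Re}\,\mathscr{L}(u,|u|^{p-2}u)\ge0$ when $p\ge2$, and $\mathrm{Re}\,\mathscr{L}(|u|^{p'-2}u,u)\ge0$ when $1<p<2$. *)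

theory Defs
  imports "HOL-Analysis.Analysis"
begin

text \<open>
  Throughout, \<open>'n\<close> indexes the space variables (so the ambient space is \<open>real ^ 'n\<close>) and
  \<open>'m\<close> indexes the components of the vector-valued functions.
\<close>

definition is_domain :: "('a::topological_space) set \<Rightarrow> bool" where
  "is_domain \<Omega> \<longleftrightarrow> open \<Omega> \<and> connected \<Omega> \<and> \<Omega> \<noteq> {}"

definition locally_integrable_on ::
    "('a::euclidean_space \<Rightarrow> 'b::euclidean_space) \<Rightarrow> 'a set \<Rightarrow> bool"
    (infixr \<open>locally'_integrable'_on\<close> 46) where
  "f locally_integrable_on \<Omega> \<longleftrightarrow>
     (\<forall>K. compact K \<longrightarrow> K \<subseteq> \<Omega> \<longrightarrow> f absolutely_integrable_on K)"

definition partial_deriv ::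
    "'n \<Rightarrow> (real ^ 'n \<Rightarrow> 'b::real_normed_vector) \<Rightarrow> real ^ 'n \<Rightarrow> 'b" where
  "partial_deriv h u x = vector_derivative (\<lambda>t. u (x + t *\<^sub>R axis h 1)) (at 0)"

text \<open>A compactly supported function on \<open>\<Omega>\<close> is identified with its extension by zero to the
  whole space, which is again \<open>C\<^sup>1\<close> when \<open>\<Omega>\<close> is open.\<close>

definition C1_0 :: "(real ^ 'n) set \<Rightarrow> (real ^ 'n \<Rightarrow> complex ^ 'm) set" where
  "C1_0 \<Omega> = {u. (\<forall>x. u differentiable (at x))
                \<and> (\<forall>h. continuous_on UNIV (partial_deriv h u))
                \<and> compact (closure {x. u x \<noteq> 0})
                \<and> closure {x. u x \<noteq> 0} \<subseteq> \<Omega>}"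

definition herm_prod :: "complex ^ 'm \<Rightarrow> complex ^ 'm \<Rightarrow> complex" where
  "herm_prod \<xi> \<eta> = (\<Sum>i\<in>UNIV. \<xi> $ i * cnj (\<eta> $ i))"

definition sesq_form ::
    "('n \<Rightarrow> real ^ 'n \<Rightarrow> real ^ 'm ^ 'm) \<Rightarrow> (real ^ 'n) set \<Rightarrow>
     (real ^ 'n \<Rightarrow> complex ^ 'm) \<Rightarrow> (real ^ 'n \<Rightarrow> complex ^ 'm) \<Rightarrow> complex" where
  "sesq_form A \<Omega> u v =
     (LINT x:\<Omega>|lebesgue.
        (\<Sum>h\<in>UNIV. herm_prod (map_matrix complex_of_real (A h x) *v partial_deriv h u x)
                           (partial_deriv h v x)))"

text \<open>The \<open>L\<^sup>p\<close>-dissipativity of \<open>u \<mapsto> \<Sum>\<^sub>h \<partial>\<^sub>h (A h \<partial>\<^sub>h u)\<close> on \<open>\<Omega>\<close>, for \<open>1 < p\<close>.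
  Where \<open>u x = 0\<close>, the product \<open>norm (u x) powr (q - 2) *\<^sub>R u x\<close> is \<open>0\<close>,
  also for \<open>q = 2\<close>, although \<open>0 powr 0 = 0\<close>.\<close>

definition Lp_dissipative ::
    "real \<Rightarrow> ('n \<Rightarrow> real ^ 'n \<Rightarrow> real ^ 'm ^ 'm) \<Rightarrow> (real ^ 'n) set \<Rightarrow> bool" where
  "Lp_dissipative p A \<Omega> \<longleftrightarrow>
     (if p \<ge> 2
      then \<forall>u\<in>C1_0 \<Omega>. Re (sesq_form A \<Omega> u (\<lambda>x. norm (u x) powr (p - 2) *\<^sub>R u x)) \<ge> 0
      else let p' = p / (p - 1) in
           \<forall>u\<in>C1_0 \<Omega>. Re (sesq_form A \<Omega> (\<lambda>x. norm (u x) powr (p' - 2) *\<^sub>R u x) u) \<ge> 0)"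

text \<open>Real eigenvalues only. For symmetric matrices these are all the eigenvalues, and they form
  a finite nonempty set, so that \<open>Min\<close> and \<open>Max\<close> below are meaningful.\<close>

definition eigenvalues :: "real ^ 'm ^ 'm \<Rightarrow> real set" where
  "eigenvalues M = {\<mu>. \<exists>v. v \<noteq> 0 \<and> M *v v = \<mu> *\<^sub>R v}"

definition min_eigenvalue :: "real ^ 'm ^ 'm \<Rightarrow> real" where
  "min_eigenvalue M = Min (eigenvalues M)"

definition max_eigenvalue :: "real ^ 'm ^ 'm \<Rightarrow> real" where
  "max_eigenvalue M = Max (eigenvalues M)"

end

theory Submission
  imports Defs
begin

text \<open>
  Put \<open>q = max p p'\<close>; the condition on the eigenvalues is the same for \<open>p\<close> and \<open>p'\<close>. By the chain
  rule, the integrand of the form with \<open>u\<close> and \<open>|u|\<^sup>q\<^sup>-\<^sup>2u\<close> is, up to the factor \<open>|u|\<^sup>q\<^sup>-\<^sup>4\<close>, the sum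
  over \<open>h\<close> of \<open>Q(u, d) = |u|\<^sup>2\<langle>Md, d\<rangle> + (q - 2)\<langle>u, d\<rangle>\<langle>u, Md\<rangle>\<close> (real scalar products) at \<open>M = \<A>\<^sup>h(x)\<close> and
  \<open>d = \<partial>\<^sub>hu\<close>. Everything rests on two facts: \<open>Q \<ge> 0\<close> is equivalent to the eigenvalue condition, and
  dissipativity localises to \<open>Q \<ge> 0\<close> at almost every point.

  For the first, minimising \<open>Q\<close> over the direction of \<open>u\<close> gives \<open>(q - 2)|d||Md| \<le> q\<langle>Md, d\<rangle>\<close>, which
  follows from \<open>|Md|\<^sup>2 + \<mu>\<^sub>1\<mu>\<^sub>m|d|\<^sup>2 \<le> (\<mu>\<^sub>1 + \<mu>\<^sub>m)\<langle>Md, d\<rangle>\<close> and the inequality of the arithmetic and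
  geometric means; conversely, one tests \<open>Q\<close> on the span of the two extreme eigenvectors.

  For the second, one inserts \<open>u = \<phi>(x)(w + \<epsilon> g(x\<^sub>h/\<epsilon>\<^sup>2)\<xi>)\<close> with \<open>g = sin\<close> and \<open>g = cos\<close> and lets
  \<open>\<epsilon> \<rightarrow> 0\<close>: only \<open>\<partial>\<^sub>hu\<close> is of order \<open>1/\<epsilon>\<close>, \<open>u\<close> tends to \<open>\<phi>w\<close>, and the two rescaled forms add up in the
  limit to the integral of \<open>|\<phi>|\<^sup>q\<close> times a multiple of \<open>Q(w, \<xi>)\<close>. Since \<open>\<phi>\<close> is arbitrary, \<open>Q(w, \<xi>) \<ge> 0\<close>
  almost everywhere, and simultaneously for all \<open>w\<close> and \<open>\<xi>\<close> by density.
\<close>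

section \<open>Symmetric matrices and the eigenvalue condition\<close>

text \<open>Rescaling \<open>a\<close> and \<open>b\<close> to the common norm \<open>k\<close>
  turns the product into a difference of two squares; the positive one is dropped and Cauchy-Schwarz
  bounds the other. Equality holds when \<open>w\<close> is a multiple of
  \<open>a' - b'\<close>.\<close>

lemma inner_times_inner_ge:
  fixes a b w :: "'a::real_inner"
  shows "(norm w)\<^sup>2 * (a \<bullet> b - norm a * norm b) / 2 \<le> (w \<bullet> a) * (w \<bullet> b)"
proof (cases "a = 0 \<or> b = 0")
  case False
  define k where "k = norm a * norm b"
  have k: "k > 0" using False by (simp add: k_def)
  define a' b' where "a' = norm b *\<^sub>R a" and "b' = norm a *\<^sub>R b"
  have n: "(norm (a' - b'))\<^sup>2 = 2 * k\<^sup>2 - 2 * k * (a \<bullet> b)"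
    unfolding power2_norm_eq_inner a'_def b'_def k_def inner_diff_left inner_diff_right
    by (simp add: inner_commute[of b a] dot_square_norm algebra_simps power2_eq_square)
  have "(w \<bullet> (a' - b'))\<^sup>2 \<le> (norm w)\<^sup>2 * (norm (a' - b'))\<^sup>2"
    using Cauchy_Schwarz_ineq[of w "a' - b'"] by (simp add: power2_norm_eq_inner)
  moreover have "4 * (k * ((w \<bullet> a) * (w \<bullet> b))) = (w \<bullet> (a' + b'))\<^sup>2 - (w \<bullet> (a' - b'))\<^sup>2"
    by (simp add: a'_def b'_def k_def inner_diff_right inner_add_right power2_eq_square algebra_simps)
  ultimately have "4 * (k * ((w \<bullet> a) * (w \<bullet> b))) \<ge> - ((norm w)\<^sup>2 * (2 * k\<^sup>2 - 2 * k * (a \<bullet> b)))"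
    unfolding n by (smt (verit) zero_le_power2)
  also have "- ((norm w)\<^sup>2 * (2 * k\<^sup>2 - 2 * k * (a \<bullet> b))) = 4 * (k * ((norm w)\<^sup>2 * (a \<bullet> b - norm a * norm b) / 2))"
    by (simp add: k_def power2_eq_square algebra_simps)
  finally show ?thesis using k by simp
qed auto

text \<open>The form Q with \<open>x\<close> for the direction d, \<open>y\<close> for Md and
  \<open>a\<close>, \<open>b\<close> for the extreme eigenvalues. No matrix appears, so that the
  estimate is also available in the real inner product space \<open>complex ^ 'm\<close>.\<close>

lemma dissipation_form_nonneg:
  fixes w x y :: "'a::real_inner"
  assumes q: "2 \<le> q" and ab: "0 \<le> a" "0 \<le> b"
    and cond: "(1/2 - 1/q)\<^sup>2 * (a + b)\<^sup>2 \<le> a * b"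
    and xy: "(norm y)\<^sup>2 + a * b * (norm x)\<^sup>2 \<le> (a + b) * (y \<bullet> x)"
  shows "0 \<le> (norm w)\<^sup>2 * (y \<bullet> x) + (q - 2) * ((w \<bullet> x) * (w \<bullet> y))"
proof -
  have main: "(q - 2) * (norm x * norm y) \<le> q * (y \<bullet> x)"
  proof (cases "a + b = 0")
    case True
    then have "a = 0" "b = 0" using ab by auto
    then have "y = 0" using xy by simp
    then show ?thesis by simp
  next
    case False
    then have s: "a + b > 0" using ab by simp
    \<comment> \<open>This is \<open>cond\<close> multiplied by \<open>(2 * q)\<^sup>2\<close>,
      since 2q(1/2 - 1/q) = q - 2.\<close>
    have "((q - 2) * (a + b))\<^sup>2 = (2 * q)\<^sup>2 * ((1/2 - 1/q)\<^sup>2 * (a + b)\<^sup>2)"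
      using q by (simp add: power_mult_distrib[symmetric] field_simps)
    also have "\<dots> \<le> (2 * q)\<^sup>2 * (a * b)" using cond by (intro mult_left_mono) auto
    also have "\<dots> = (2 * q * sqrt (a * b))\<^sup>2" using ab by (simp add: power_mult_distrib)
    finally have 1: "(q - 2) * (a + b) \<le> 2 * q * sqrt (a * b)"
      using q ab by (auto intro: power2_le_imp_le)
    have "0 \<le> (norm y - sqrt (a * b) * norm x)\<^sup>2" by simp
    then have 2: "2 * sqrt (a * b) * (norm x * norm y) \<le> (a + b) * (y \<bullet> x)"
      using xy ab by (simp add: power2_diff power_mult_distrib algebra_simps)
    have "(a + b) * ((q - 2) * (norm x * norm y)) = ((q - 2) * (a + b)) * (norm x * norm y)" by simp
    also have "\<dots> \<le> (2 * q * sqrt (a * b)) * (norm x * norm y)"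
      by (intro mult_right_mono 1) auto
    also have "\<dots> = q * (2 * sqrt (a * b) * (norm x * norm y))" by simp
    also have "\<dots> \<le> q * ((a + b) * (y \<bullet> x))" using q by (intro mult_left_mono 2) auto
    finally have "(a + b) * ((q - 2) * (norm x * norm y)) \<le> (a + b) * (q * (y \<bullet> x))" by (simp add: mult_ac)
    then show ?thesis using s by simp
  qed
  have "(q - 2) * ((w \<bullet> x) * (w \<bullet> y)) \<ge> (q - 2) * ((norm w)\<^sup>2 * (x \<bullet> y - norm x * norm y) / 2)"
    using q by (intro mult_left_mono inner_times_inner_ge) auto
  moreover have "(norm w)\<^sup>2 * ((q - 2) * (norm x * norm y)) \<le> (norm w)\<^sup>2 * (q * (y \<bullet> x))"
    using main by (intro mult_left_mono) auto
  ultimately show ?thesis by (simp add: inner_commute algebra_simps add_divide_distrib diff_divide_distrib)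
qed

lemma symmetric_matrix_inner:
  fixes M :: "real ^ 'm ^ 'm"
  assumes "transpose M = M"
  shows "(M *v x) \<bullet> y = x \<bullet> (M *v y)"
  using assms by (metis dot_lmul_matrix transpose_matrix_vector inner_commute)

section \<open>Nonnegative quadratic forms\<close>

lemma quadratic_form_discriminant:
  fixes a b c :: real
  assumes "\<And>s t. 0 \<le> a * s\<^sup>2 + b * s * t + c * t\<^sup>2"
  shows "b\<^sup>2 \<le> 4 * a * c"
proof -
  have a: "0 \<le> a" using assms[of 1 0] by simp
  have c: "0 \<le> c" using assms[of 0 1] by simp
  show ?thesis
  proof (cases "a = 0")
    case True
    have "b = 0"
    proof (rule ccontr)
      assume "b \<noteq> 0"
      then show False using assms[of "- (c + 1) / b" 1] True by simp
    qed
    then show ?thesis using True by simp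
  next
    case False
    then have "a > 0" using a by simp
    \<comment> \<open>For \<open>t = -2*a\<close> the minimising \<open>s\<close> is
      \<open>b\<close>.\<close>
    have "0 \<le> a * (a * b\<^sup>2 + b * b * (- 2 * a) + c * (- 2 * a)\<^sup>2)" using assms[of b "-2*a"] a by simp
    also have "\<dots> = a\<^sup>2 * (4 * a * c - b\<^sup>2)" by (simp add: power2_eq_square algebra_simps)
    finally show ?thesis using \<open>a > 0\<close> by (simp add: zero_le_mult_iff)
  qed
qed

text \<open>The discriminant inequality for the form on the span of \<open>x\<close> and
  \<open>y\<close>. With \<open>y = M *v x\<close> it shows that an isotropic vector lies in the
  kernel.\<close>

lemma psd_cauchy_schwarz:
  fixes M :: "real ^ 'm ^ 'm"
  assumes sym: "transpose M = M" and psd: "\<And>x. 0 \<le> (M *v x) \<bullet> x"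
  shows "((M *v x) \<bullet> y)\<^sup>2 \<le> ((M *v x) \<bullet> x) * ((M *v y) \<bullet> y)"
proof -
  have "0 \<le> ((M *v x) \<bullet> x) * s\<^sup>2 + (2 * ((M *v x) \<bullet> y)) * s * t + ((M *v y) \<bullet> y) * t\<^sup>2" for s t
    using psd[of "s *\<^sub>R x + t *\<^sub>R y"] symmetric_matrix_inner[OF sym, of y x]
    by (simp add: matrix_vector_right_distrib matrix_vector_mult_scaleR inner_add_left inner_add_right
        power2_eq_square algebra_simps inner_commute)
  from quadratic_form_discriminant[OF this] show ?thesis by (simp add: power2_eq_square)
qed

text \<open>Cauchy-Schwarz with \<open>y = M *v x\<close>, for which <Mx, y> = |Mx|^2; one factor
  |y|^2 then cancels. This is M^2 <= cM without diagonalising \<open>M\<close>.\<close>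

lemma psd_upper_bound_norm:
  fixes M :: "real ^ 'm ^ 'm"
  assumes sym: "transpose M = M" and psd: "\<And>x. 0 \<le> (M *v x) \<bullet> x"
    and le: "\<And>x. (M *v x) \<bullet> x \<le> c * (norm x)\<^sup>2"
  shows "(norm (M *v x))\<^sup>2 \<le> c * ((M *v x) \<bullet> x)"
proof (cases "M *v x = 0")
  case False
  define y where "y = M *v x"
  have "((norm y)\<^sup>2)\<^sup>2 \<le> ((M *v x) \<bullet> x) * ((M *v y) \<bullet> y)"
    using psd_cauchy_schwarz[OF sym psd, of x y] by (simp add: y_def power2_norm_eq_inner)
  also have "\<dots> \<le> ((M *v x) \<bullet> x) * (c * (norm y)\<^sup>2)"
    by (intro mult_left_mono le psd)
  finally have "(norm y)\<^sup>2 * (norm y)\<^sup>2 \<le> (c * ((M *v x) \<bullet> x)) * (norm y)\<^sup>2"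
    by (simp add: power2_eq_square mult_ac)
  then have "(norm y)\<^sup>2 \<le> c * ((M *v x) \<bullet> x)"
    by (rule mult_right_le_imp_le) (use False in \<open>simp add: y_def\<close>)
  then show ?thesis by (simp add: y_def)
qed (use psd[of x] in auto)

section \<open>Extreme eigenvalues and the Rayleigh quotient\<close>

lemma finite_eigenvalues:
  fixes M :: "real ^ 'm ^ 'm"
  assumes sym: "transpose M = M"
  shows "finite (eigenvalues M)"
proof -
  have "\<forall>\<mu>\<in>eigenvalues M. \<exists>v. v \<noteq> 0 \<and> M *v v = \<mu> *\<^sub>R v" by (simp add: eigenvalues_def)
  then obtain v where v: "\<And>\<mu>. \<mu> \<in> eigenvalues M \<Longrightarrow> v \<mu> \<noteq> 0 \<and> M *v v \<mu> = \<mu> *\<^sub>R v \<mu>"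
    using bchoice[of "eigenvalues M" "\<lambda>\<mu> v. v \<noteq> 0 \<and> M *v v = \<mu> *\<^sub>R v"] by blast
  \<comment> \<open>Eigenvectors to different eigenvalues are orthogonal, so choosing one for each
    eigenvalue embeds the spectrum into an independent, hence finite, set.\<close>
  have orth: "v \<mu> \<bullet> v \<nu> = 0" if "\<mu> \<in> eigenvalues M" "\<nu> \<in> eigenvalues M" "\<mu> \<noteq> \<nu>" for \<mu> \<nu>
    using symmetric_matrix_inner[OF sym, of "v \<mu>" "v \<nu>"] v[of \<mu>] v[of \<nu>] that by simp
  have inj: "inj_on v (eigenvalues M)"
    by (rule inj_onI) (metis inner_eq_zero_iff orth v)
  have "pairwise orthogonal (v ` eigenvalues M)"
    using orth by (fastforce simp: pairwise_def orthogonal_def)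
  then have "independent (v ` eigenvalues M)"
    by (rule pairwise_orthogonal_independent) (use v in auto)
  then show ?thesis
    using inj by (meson finite_imageD independent_imp_finite)
qed

text \<open>A minimiser of the Rayleigh quotient is an eigenvector: on the nonnegative form
  \<open>M - \<mu>\<close> it is isotropic, hence in the kernel by Cauchy--Schwarz.\<close>

lemma ex_min_rayleigh:
  fixes M :: "real ^ 'm ^ 'm"
  assumes sym: "transpose M = M"
  shows "\<exists>\<mu> e. e \<noteq> 0 \<and> M *v e = \<mu> *\<^sub>R e \<and> (\<forall>x. \<mu> * (norm x)\<^sup>2 \<le> (M *v x) \<bullet> x)"
proof -
  have "continuous_on (sphere 0 1) (\<lambda>x. (M *v x) \<bullet> x)"
    by (intro continuous_intros matrix_vector_mult_linear_continuous_on)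
  moreover have "sphere (0 :: real ^ 'm) 1 \<noteq> {}" by simp
  ultimately obtain e where e: "norm e = 1" and min: "\<And>x. norm x = 1 \<Longrightarrow> (M *v e) \<bullet> e \<le> (M *v x) \<bullet> x"
    using continuous_attains_inf[of "sphere 0 1" "\<lambda>x. (M *v x) \<bullet> x"] by auto
  define \<mu> where "\<mu> = (M *v e) \<bullet> e"
  have le: "\<mu> * (norm x)\<^sup>2 \<le> (M *v x) \<bullet> x" for x
  proof (cases "x = 0")
    case False
    have "\<mu> \<le> (M *v (x /\<^sub>R norm x)) \<bullet> (x /\<^sub>R norm x)"
      unfolding \<mu>_def using False by (intro min) simp
    also have "\<dots> = ((M *v x) \<bullet> x) / (norm x)\<^sup>2"
      by (simp add: matrix_vector_mult_scaleR power2_eq_square divide_inverse)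
    finally show ?thesis using False by (simp add: field_simps)
  qed simp
  define N where "N = M - \<mu> *\<^sub>R mat 1"
  have Nv: "N *v x = M *v x - \<mu> *\<^sub>R x" for x
    by (simp add: N_def matrix_vector_mult_diff_rdistrib scaleR_matrix_vector_assoc[symmetric])
  have symN: "transpose N = N"
    using sym by (simp add: N_def transpose_def vec_eq_iff mat_def)
  have psd: "0 \<le> (N *v x) \<bullet> x" for x
    using le[of x] by (simp add: Nv inner_diff_left power2_norm_eq_inner)
  have "((N *v e) \<bullet> (N *v e))\<^sup>2 \<le> ((N *v e) \<bullet> e) * ((N *v (N *v e)) \<bullet> (N *v e))"
    by (rule psd_cauchy_schwarz[OF symN psd])
  also have "(N *v e) \<bullet> e = 0" using e by (simp add: Nv inner_diff_left \<mu>_def dot_square_norm)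
  finally have "N *v e = 0" by simp
  then have "M *v e = \<mu> *\<^sub>R e" by (simp add: Nv)
  with e le show ?thesis by (intro exI[of _ \<mu>] exI[of _ e]) auto
qed

text \<open>The minimum of the Rayleigh quotient is itself an eigenvalue and a lower bound for all
  the others; as the spectrum is finite, it equals \<open>Min\<close>.\<close>

lemma min_eigenvalue_rayleigh:
  fixes M :: "real ^ 'm ^ 'm"
  assumes sym: "transpose M = M"
  shows "\<exists>e. e \<noteq> 0 \<and> M *v e = min_eigenvalue M *\<^sub>R e"
    and "min_eigenvalue M * (norm x)\<^sup>2 \<le> (M *v x) \<bullet> x"
proof -
  obtain \<mu> e where e: "e \<noteq> 0" "M *v e = \<mu> *\<^sub>R e" and le: "\<And>x. \<mu> * (norm x)\<^sup>2 \<le> (M *v x) \<bullet> x"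
    using ex_min_rayleigh[OF sym] by auto
  have "\<mu> \<le> \<nu>" if "\<nu> \<in> eigenvalues M" for \<nu>
  proof -
    from that obtain v where "v \<noteq> 0" "M *v v = \<nu> *\<^sub>R v" by (auto simp: eigenvalues_def)
    then show ?thesis using le[of v] by (simp add: power2_norm_eq_inner)
  qed
  then have "min_eigenvalue M = \<mu>"
    unfolding min_eigenvalue_def using e finite_eigenvalues[OF sym]
    by (intro Min_eqI) (auto simp: eigenvalues_def)
  then show "\<exists>e. e \<noteq> 0 \<and> M *v e = min_eigenvalue M *\<^sub>R e"
    and "min_eigenvalue M * (norm x)\<^sup>2 \<le> (M *v x) \<bullet> x"
    using e le by auto
qed

lemma matrix_minus_vector_mult:
  fixes M :: "real ^ 'n ^ 'm"
  shows "(- M) *v x = - (M *v x)"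
  using matrix_vector_mult_diff_rdistrib[of 0 M x] by simp

lemma max_eigenvalue_rayleigh:
  fixes M :: "real ^ 'm ^ 'm"
  assumes sym: "transpose M = M"
  shows "\<exists>e. e \<noteq> 0 \<and> M *v e = max_eigenvalue M *\<^sub>R e"
    and "(M *v x) \<bullet> x \<le> max_eigenvalue M * (norm x)\<^sup>2"
proof -
  have "transpose (- M) = - M" using sym by (simp add: transpose_def vec_eq_iff)
  then obtain \<mu> e where e: "e \<noteq> 0" "(- M) *v e = \<mu> *\<^sub>R e"
    and le: "\<And>x. \<mu> * (norm x)\<^sup>2 \<le> ((- M) *v x) \<bullet> x"
    using ex_min_rayleigh[of "- M"] by auto
  have e': "M *v e = (- \<mu>) *\<^sub>R e"
    using arg_cong[OF e(2), of uminus] by (simp add: matrix_minus_vector_mult)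
  have le': "(M *v x) \<bullet> x \<le> - \<mu> * (norm x)\<^sup>2" for x
    using le[of x] by (simp add: matrix_minus_vector_mult)
  have "\<nu> \<le> - \<mu>" if "\<nu> \<in> eigenvalues M" for \<nu>
  proof -
    from that obtain v where "v \<noteq> 0" "M *v v = \<nu> *\<^sub>R v" by (auto simp: eigenvalues_def)
    then have "0 < (norm v)\<^sup>2" "\<nu> * (norm v)\<^sup>2 \<le> - \<mu> * (norm v)\<^sup>2"
      using le'[of v] by (simp_all add: power2_norm_eq_inner)
    then show ?thesis by (metis mult_right_le_imp_le)
  qed
  then have "max_eigenvalue M = - \<mu>"
    unfolding max_eigenvalue_def using e(1) e' finite_eigenvalues[OF sym]
    by (intro Max_eqI) (auto simp: eigenvalues_def)
  then show "\<exists>e. e \<noteq> 0 \<and> M *v e = max_eigenvalue M *\<^sub>R e"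
    and "(M *v x) \<bullet> x \<le> max_eigenvalue M * (norm x)\<^sup>2"
    using e(1) e' le' by auto
qed

text \<open>Nonnegativity of the product (M - a)(b - M): the matrix N = M - a satisfies 0 <= N <= b
  - a, whence |Nx|^2 <= (b - a)<Nx, x>, and this expands to the claim.\<close>

lemma eigenvalue_enclosure:
  fixes M :: "real ^ 'm ^ 'm"
  assumes sym: "transpose M = M"
  defines "a \<equiv> min_eigenvalue M" and "b \<equiv> max_eigenvalue M"
  shows "(norm (M *v x))\<^sup>2 + a * b * (norm x)\<^sup>2 \<le> (a + b) * ((M *v x) \<bullet> x)"
proof -
  define N where "N = M - a *\<^sub>R mat 1"
  have Nv: "N *v x = M *v x - a *\<^sub>R x" for x
    by (simp add: N_def matrix_vector_mult_diff_rdistrib scaleR_matrix_vector_assoc[symmetric])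
  have symN: "transpose N = N"
    using sym by (simp add: N_def transpose_def vec_eq_iff mat_def)
  have "(norm (N *v x))\<^sup>2 \<le> (b - a) * ((N *v x) \<bullet> x)"
  proof (rule psd_upper_bound_norm[OF symN])
    show "0 \<le> (N *v x) \<bullet> x" for x
      using min_eigenvalue_rayleigh(2)[OF sym, of x]
      by (simp add: Nv inner_diff_left power2_norm_eq_inner a_def)
    show "(N *v x) \<bullet> x \<le> (b - a) * (norm x)\<^sup>2" for x
      using max_eigenvalue_rayleigh(2)[OF sym, of x]
      by (simp add: Nv inner_diff_left power2_norm_eq_inner b_def algebra_simps)
  qed
  then show ?thesis
    by (simp add: Nv power2_norm_eq_inner inner_diff_left inner_diff_right inner_commute algebra_simps)
qed

lemma psd_eigenvalues_nonneg:
  fixes M :: "real ^ 'm ^ 'm"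
  assumes sym: "transpose M = M" and psd: "\<And>x. 0 \<le> (M *v x) \<bullet> x"
  shows "0 \<le> min_eigenvalue M" "0 \<le> max_eigenvalue M"
proof -
  obtain e where "e \<noteq> 0" "M *v e = min_eigenvalue M *\<^sub>R e"
    using min_eigenvalue_rayleigh(1)[OF sym] by blast
  then show "0 \<le> min_eigenvalue M" using psd[of e] by (auto simp: zero_le_mult_iff simp flip: power2_norm_eq_inner)
  obtain e where "e \<noteq> 0" "M *v e = max_eigenvalue M *\<^sub>R e"
    using max_eigenvalue_rayleigh(1)[OF sym] by blast
  then show "0 \<le> max_eigenvalue M" using psd[of e] by (auto simp: zero_le_mult_iff simp flip: power2_norm_eq_inner)
qed

lemma unit_eigenvector:
  fixes M :: "real ^ 'm ^ 'm"
  assumes "\<exists>e. e \<noteq> 0 \<and> M *v e = \<mu> *\<^sub>R e"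
  shows "\<exists>e. norm e = 1 \<and> M *v e = \<mu> *\<^sub>R e"
proof -
  from assms obtain e where "e \<noteq> 0" "M *v e = \<mu> *\<^sub>R e" by blast
  then show ?thesis
    by (intro exI[of _ "e /\<^sub>R norm e"]) (simp_all add: matrix_vector_mult_scaleR)
qed

text \<open>Testing with \<open>w = e + f\<close>, the sum of unit eigenvectors to the extreme eigenvalues, leaves a
  quadratic form on the span of \<open>e\<close> and \<open>f\<close> whose discriminant is the eigenvalue condition.\<close>

lemma eigenvalue_condition_necessary:
  fixes M :: "real ^ 'm ^ 'm"
  assumes q: "2 \<le> q" and sym: "transpose M = M"
    and form: "\<And>w x. 0 \<le> (norm w)\<^sup>2 * ((M *v x) \<bullet> x) + (q - 2) * ((w \<bullet> x) * (w \<bullet> (M *v x)))"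
  shows "(1/2 - 1/q)\<^sup>2 * (min_eigenvalue M + max_eigenvalue M)\<^sup>2 \<le> min_eigenvalue M * max_eigenvalue M"
proof -
  define a b where "a = min_eigenvalue M" and "b = max_eigenvalue M"
  obtain e where e: "norm e = 1" "M *v e = a *\<^sub>R e"
    unfolding a_def using unit_eigenvector[OF min_eigenvalue_rayleigh(1)[OF sym]] by blast
  obtain f where f: "norm f = 1" "M *v f = b *\<^sub>R f"
    unfolding b_def using unit_eigenvector[OF max_eigenvalue_rayleigh(1)[OF sym]] by blast
  show ?thesis
  proof (cases "a = b")
    \<comment> \<open>The two eigenvectors need not be orthogonal here, but |1/2 - 1/q| <= 1/2
      already gives the claim.\<close>
    case True
    have "(1/2 - 1/q)\<^sup>2 \<le> (1/2)\<^sup>2" using q by (intro power_mono) (auto simp: field_simps)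
    then have "(1/2 - 1/q)\<^sup>2 * (2 * b)\<^sup>2 \<le> (1/2)\<^sup>2 * (2 * b)\<^sup>2" by (intro mult_right_mono) auto
    also have "\<dots> = b * b" by (simp add: power2_eq_square)
    finally show ?thesis using True by (simp add: a_def b_def)
  next
    case False
    have orth: "e \<bullet> f = 0"
      using symmetric_matrix_inner[OF sym, of e f] e f False by simp
    have ee: "e \<bullet> e = 1" "f \<bullet> f = 1" "f \<bullet> e = 0"
      using e f orth by (simp_all add: dot_square_norm inner_commute)
    have w: "(norm (e + f))\<^sup>2 = 2"
      unfolding power2_norm_eq_inner using ee orth by (simp add: inner_add_left inner_add_right)
    \<comment> \<open>For x = se + tf the three factors are as^2 + bt^2, s + t and as + bt, so the
      diagonal coefficients are 2a + (q - 2)a = qa and likewise qb.\<close>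
    have "0 \<le> (q * a) * s\<^sup>2 + ((q - 2) * (a + b)) * s * t + (q * b) * t\<^sup>2" for s t
      using form[of "e + f" "s *\<^sub>R e + t *\<^sub>R f"] unfolding w
      using e(2) f(2) ee orth
      by (simp add: matrix_vector_right_distrib matrix_vector_mult_scaleR inner_add_left
          inner_add_right power2_eq_square algebra_simps)
    from quadratic_form_discriminant[OF this]
    have "((q - 2) * (a + b))\<^sup>2 / (2 * q)\<^sup>2 \<le> a * b"
      using q by (simp add: field_simps power2_eq_square)
    moreover have "((q - 2) * (a + b))\<^sup>2 / (2 * q)\<^sup>2 = (1/2 - 1/q)\<^sup>2 * (a + b)\<^sup>2"
      using q by (simp add: power_mult_distrib[symmetric] power_divide[symmetric] field_simps)
    ultimately show ?thesis by (simp add: a_def b_def)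
  qed
qed

section \<open>Trace and determinant in dimension two\<close>

lemma eigenvalue_quadratic_2:
  fixes a b d :: real
  assumes "x \<noteq> 0 \<or> y \<noteq> 0" "a * x + b * y = \<mu> * x" "b * x + d * y = \<mu> * y"
  shows "\<mu>\<^sup>2 - (a + d) * \<mu> + (a * d - b * b) = 0"
proof -
  have 1: "(a - \<mu>) * x = - b * y" "(d - \<mu>) * y = - b * x" using assms by (auto simp: algebra_simps)
  \<comment> \<open>One row of the eigenvector equation is substituted into the other; whichever
    coordinate is nonzero can then be cancelled.\<close>
  have "(d - \<mu>) * ((a - \<mu>) * x) = b * b * x" "(a - \<mu>) * ((d - \<mu>) * y) = b * b * y"
    unfolding 1 using arg_cong[OF 1(2), of "(*) b"] arg_cong[OF 1(1), of "(*) b"]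
    by (simp_all add: algebra_simps)
  then have "((a - \<mu>) * (d - \<mu>) - b * b) * x = 0" "((a - \<mu>) * (d - \<mu>) - b * b) * y = 0"
    by (simp_all add: algebra_simps)
  then have "(a - \<mu>) * (d - \<mu>) - b * b = 0" using assms(1) by auto
  then show ?thesis by (simp add: power2_eq_square algebra_simps)
qed

text \<open>Both extreme eigenvalues are roots of the characteristic polynomial. If they differ,
  Vieta's formulas apply. If they coincide, the equation alone does not show a double root, but
  \<open>eigenvalue_enclosure\<close> forces \<open>M\<close> to be a multiple of the
  identity.\<close>

lemma trace_det_eigenvalues_2:
  fixes M :: "real ^ 'm ^ 'm"
  assumes card: "CARD('m) = 2" and sym: "transpose M = M"
  shows "trace M = min_eigenvalue M + max_eigenvalue M"
    and "det M = min_eigenvalue M * max_eigenvalue M"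
proof -
  obtain i j :: 'm where ij: "UNIV = {i, j}" "i \<noteq> j"
    using card by (auto simp: card_2_iff)
  define a b d where "a = M $ i $ i" and "b = M $ i $ j" and "d = M $ j $ j"
  have b': "M $ j $ i = b" using sym by (metis b_def transpose_def vec_lambda_beta)
  have tr: "trace M = a + d" unfolding trace_def ij(1) using ij(2) by (simp add: a_def d_def)
  have det: "det M = a * d - b * b"
    unfolding det_def ij(1)
    using ij(2) b'
    by (subst sum_over_permutations_insert)
      (auto simp: permutes_sing sign_swap_id sign_id a_def b_def d_def transpose_def[where 'a = 'm])
  have root: "\<mu>\<^sup>2 - trace M * \<mu> + det M = 0" if ev: "\<exists>v. v \<noteq> 0 \<and> M *v v = \<mu> *\<^sub>R v" for \<mu>
  proof -
    from ev obtain v where v: "v \<noteq> 0" "M *v v = \<mu> *\<^sub>R v" by blast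
    have nz: "v $ i \<noteq> 0 \<or> v $ j \<noteq> 0"
      using v(1) ij(1) by (metis UNIV_I empty_iff insert_iff vec_eq_iff zero_index)
    have "(M *v v) $ i = \<mu> * v $ i" "(M *v v) $ j = \<mu> * v $ j" using v(2) by simp_all
    then have "a * v $ i + b * v $ j = \<mu> * v $ i" "b * v $ i + d * v $ j = \<mu> * v $ j"
      unfolding matrix_vector_mult_def vec_lambda_beta ij(1) using ij(2) b'
      by (simp_all add: a_def b_def d_def)
    from eigenvalue_quadratic_2[OF nz this] show ?thesis by (simp add: tr det)
  qed
  define \<mu> \<nu> where "\<mu> = min_eigenvalue M" and "\<nu> = max_eigenvalue M"
  have r: "\<mu>\<^sup>2 - trace M * \<mu> + det M = 0" "\<nu>\<^sup>2 - trace M * \<nu> + det M = 0"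
    unfolding \<mu>_def \<nu>_def
    using root min_eigenvalue_rayleigh(1)[OF sym] max_eigenvalue_rayleigh(1)[OF sym] by blast+
  have "trace M = \<mu> + \<nu> \<and> det M = \<mu> * \<nu>"
  proof (cases "\<mu> = \<nu>")
    case False
    have "(\<mu> - \<nu>) * (\<mu> + \<nu> - trace M) = 0" using r by (simp add: power2_eq_square algebra_simps)
    then have "trace M = \<mu> + \<nu>" using False by simp
    with r(1) show ?thesis by (simp add: power2_eq_square algebra_simps)
  next
    case True
    have "(norm (M *v x - \<mu> *\<^sub>R x))\<^sup>2 \<le> 0" for x
      using eigenvalue_enclosure[OF sym, of x] True
      by (simp add: \<mu>_def \<nu>_def power2_norm_eq_inner inner_diff_left inner_diff_right inner_commute algebra_simps)
    then have "M *v x = \<mu> *\<^sub>R x" for x by simp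
    then have "M = \<mu> *\<^sub>R mat 1"
      by (metis matrix_eq matrix_vector_mul_lid scaleR_matrix_vector_assoc)
    then have "a = \<mu>" "b = 0" "d = \<mu>" using ij(2) by (simp_all add: a_def b_def d_def mat_def)
    then show ?thesis using True by (simp add: tr det)
  qed
  then show "trace M = min_eigenvalue M + max_eigenvalue M"
    and "det M = min_eigenvalue M * max_eigenvalue M" by (simp_all add: \<mu>_def \<nu>_def)
qed

section \<open>Differentiation\<close>

text \<open>The derivative of \<open>|u|\<^sup>q\<^sup>-\<^sup>2u\<close> in a direction in which \<open>u\<close> has the derivative \<open>d\<close>. Since \<open>0 powr 0 = 0\<close>,
  this formula is wrong where \<open>u = 0\<close> if \<open>q = 2\<close>, and only there.\<close>

definition lp_deriv :: "real \<Rightarrow> 'a::real_inner \<Rightarrow> 'a \<Rightarrow> 'a" where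
  "lp_deriv q u d = norm u powr (q - 2) *\<^sub>R d + ((q - 2) * norm u powr (q - 4) * (u \<bullet> d)) *\<^sub>R u"

text \<open>Away from the zeros of \<open>c\<close> this is the chain rule. At a zero the difference
  quotient is |c|^(q - 2) times a bounded quantity, so by \<open>2 < q\<close> the derivative is 0,
  and so is \<open>lp_deriv\<close> there.\<close>

lemma has_vector_derivative_norm_powr_scaleR:
  fixes c :: "real \<Rightarrow> 'a::real_inner"
  assumes q: "2 < q" and c: "(c has_vector_derivative d) (at t)"
  shows "((\<lambda>s. norm (c s) powr (q - 2) *\<^sub>R c s) has_vector_derivative lp_deriv q (c t) d) (at t)"
proof (cases "c t = 0")
  case False
  have "((\<lambda>s. norm (c s)) has_derivative (\<lambda>h. (h *\<^sub>R d) \<bullet> sgn (c t))) (at t)"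
    using has_derivative_compose[OF c[unfolded has_vector_derivative_def] has_derivative_norm[OF False]] .
  then have n: "((\<lambda>s. norm (c s)) has_real_derivative (c t \<bullet> d) / norm (c t)) (at t)"
    unfolding has_field_derivative_def
    by (rule has_derivative_eq_rhs) (auto simp: sgn_div_norm inner_commute fun_eq_iff divide_inverse)
  have "((\<lambda>z. z powr (q - 2)) has_real_derivative (q - 2) * norm (c t) powr (q - 2 - 1)) (at (norm (c t)))"
    using False by (intro has_real_derivative_powr) simp
  from DERIV_chain2[OF this n] have
    "((\<lambda>s. norm (c s) powr (q - 2)) has_real_derivative
      (q - 2) * norm (c t) powr (q - 2 - 1) * ((c t \<bullet> d) / norm (c t))) (at t)" .
  from has_vector_derivative_scaleR[OF this c]
  have "((\<lambda>s. norm (c s) powr (q - 2) *\<^sub>R c s) has_vector_derivative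
     norm (c t) powr (q - 2) *\<^sub>R d + ((q - 2) * norm (c t) powr (q - 2 - 1) * ((c t \<bullet> d) / norm (c t))) *\<^sub>R c t) (at t)" .
  moreover have "norm (c t) powr (q - 2 - 1) / norm (c t) = norm (c t) powr (q - 4)"
    using False powr_diff[of "norm (c t)" "q - 3" 1] by simp
  then have "(q - 2) * norm (c t) powr (q - 2 - 1) * ((c t \<bullet> d) / norm (c t)) = (q - 2) * norm (c t) powr (q - 4) * (c t \<bullet> d)"
    by (metis times_divide_eq_left times_divide_eq_right)
  ultimately show ?thesis by (simp add: lp_deriv_def)
next
  case True
  have lim: "((\<lambda>h. norm (c (t + h) - h *\<^sub>R d) / norm h) \<longlongrightarrow> 0) (at 0)"
    using c unfolding has_vector_derivative_def has_derivative_at by (simp add: True)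
  have "(c \<longlongrightarrow> 0) (at t)"
    using has_vector_derivative_continuous[OF c] True by (simp add: continuous_within)
  then have "((\<lambda>h. c (t + h)) \<longlongrightarrow> 0) (at 0)" by (simp add: LIM_offset_zero)
  then have "((\<lambda>h. norm (c (t + h)) powr (q - 2)) \<longlongrightarrow> 0) (at 0)"
    using q by (intro tendsto_zero_powrI[where b = "q - 2"] tendsto_norm_zero tendsto_const) auto
  \<comment> \<open>The second factor dominates |c(t + h)|/|h| and tends to \<open>norm d\<close>;
    the first tends to 0 because \<open>2 < q\<close>.\<close>
  from tendsto_mult[OF this tendsto_add[OF lim tendsto_const[of "norm d"]]]
  have "((\<lambda>h. norm (c (t + h)) powr (q - 2) * (norm (c (t + h) - h *\<^sub>R d) / norm h + norm d)) \<longlongrightarrow> 0) (at 0)"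
    by simp
  then have "((\<lambda>h. norm (norm (c (t + h)) powr (q - 2) *\<^sub>R c (t + h)) / norm h) \<longlongrightarrow> 0) (at 0)"
  proof (rule Lim_null_comparison[rotated])
    show "\<forall>\<^sub>F h in at 0. norm (norm (norm (c (t + h)) powr (q - 2) *\<^sub>R c (t + h)) / norm h)
        \<le> norm (c (t + h)) powr (q - 2) * (norm (c (t + h) - h *\<^sub>R d) / norm h + norm d)"
      unfolding eventually_at_filter
    proof (intro always_eventually allI impI)
      fix h :: real assume h: "h \<noteq> 0"
      have "norm (c (t + h)) \<le> norm (c (t + h) - h *\<^sub>R d) + norm (h *\<^sub>R d)"
        by (metis diff_add_cancel norm_triangle_ineq)
      then have "norm (c (t + h)) / norm h \<le> norm (c (t + h) - h *\<^sub>R d) / norm h + norm d"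
        using h by (simp add: field_simps)
      then show "norm (norm (norm (c (t + h)) powr (q - 2) *\<^sub>R c (t + h)) / norm h)
        \<le> norm (c (t + h)) powr (q - 2) * (norm (c (t + h) - h *\<^sub>R d) / norm h + norm d)"
        by (simp add: mult_left_mono flip: times_divide_eq_right)
    qed
  qed
  then show ?thesis
    unfolding has_vector_derivative_def has_derivative_at by (simp add: True lp_deriv_def)
qed

lemma inner_lp_deriv:
  "y \<bullet> lp_deriv q u d = norm u powr (q - 2) * (y \<bullet> d) + (q - 2) * norm u powr (q - 4) * (u \<bullet> d) * (y \<bullet> u)"
  by (simp add: lp_deriv_def inner_add_right)

text \<open>For y = Md the second factor is Q(u, d), so the integrand and Q have the same sign where
  \<open>u\<close> does not vanish.\<close>

lemma lp_deriv_form: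
  assumes "u \<noteq> 0"
  shows "y \<bullet> lp_deriv q u d =
    norm u powr (q - 4) * ((norm u)\<^sup>2 * (y \<bullet> d) + (q - 2) * ((u \<bullet> d) * (u \<bullet> y)))"
proof -
  have "norm u powr (q - 2) = norm u powr (q - 4) * (norm u)\<^sup>2"
    using assms powr_add[of "norm u" "q - 4" 2] by simp
  then show ?thesis by (simp add: inner_lp_deriv algebra_simps inner_commute)
qed

lemma lp_deriv_scaleR: "lp_deriv q u (s *\<^sub>R d) = s *\<^sub>R lp_deriv q u d"
  by (simp add: lp_deriv_def scaleR_add_right mult_ac)

lemma lp_deriv_add: "lp_deriv q u (d + e) = lp_deriv q u d + lp_deriv q u e"
  by (simp add: lp_deriv_def inner_add_right algebra_simps)

lemma lp_deriv_homogeneous: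
  assumes "c \<noteq> 0"
  shows "lp_deriv q (c *\<^sub>R u) d = \<bar>c\<bar> powr (q - 2) *\<^sub>R lp_deriv q u d"
proof -
  have "\<bar>c\<bar> powr (q - 2) = \<bar>c\<bar> powr (q - 4) * c\<^sup>2"
    using assms powr_add[of "\<bar>c\<bar>" "q - 4" 2] by simp
  then show ?thesis
    by (simp add: lp_deriv_def powr_mult scaleR_add_right power2_eq_square algebra_simps)
qed

text \<open>The constant is 1 + (q - 2), one contribution from each term of
  \<open>lp_deriv\<close>.\<close>

lemma norm_lp_deriv_le:
  assumes "2 \<le> q"
  shows "norm (lp_deriv q u d) \<le> (q - 1) * norm u powr (q - 2) * norm d"
proof (cases "u = 0")
  case False
  have eq: "norm u powr (q - 4) * (norm u * norm u) = norm u powr (q - 2)"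
    using False powr_add[of "norm u" "q - 4" 2] by (simp add: power2_eq_square)
  have "norm (lp_deriv q u d) \<le> norm u powr (q - 2) * norm d + (q - 2) * norm u powr (q - 4) * \<bar>u \<bullet> d\<bar> * norm u"
    unfolding lp_deriv_def using assms
    by (intro order.trans[OF norm_triangle_ineq]) (simp add: abs_mult)
  also have "\<dots> \<le> norm u powr (q - 2) * norm d + (q - 2) * norm u powr (q - 4) * (norm u * norm d) * norm u"
    using assms by (intro add_left_mono mult_right_mono mult_left_mono Cauchy_Schwarz_ineq2) auto
  also have "\<dots> = norm u powr (q - 2) * norm d + (q - 2) * (norm u powr (q - 4) * (norm u * norm u)) * norm d"
    by (simp add: algebra_simps)
  also have "\<dots> = (q - 1) * norm u powr (q - 2) * norm d"
    unfolding eq by (simp add: algebra_simps)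
  finally show ?thesis .
qed (simp add: lp_deriv_def)

lemma tendsto_lp_deriv:
  assumes "(u \<longlongrightarrow> u0) F" "(d \<longlongrightarrow> d0) F" "u0 \<noteq> 0"
  shows "((\<lambda>n. lp_deriv q (u n) (d n)) \<longlongrightarrow> lp_deriv q u0 d0) F"
  unfolding lp_deriv_def using assms by (intro tendsto_intros) auto

section \<open>Calculus of continuously differentiable functions\<close>

definition C1_fun :: "(real ^ 'n \<Rightarrow> 'b::real_normed_vector) \<Rightarrow> bool" where
  "C1_fun f \<longleftrightarrow> (\<forall>x. f differentiable (at x)) \<and> (\<forall>h. continuous_on UNIV (partial_deriv h f))"

lemma has_vector_derivative_line:
  assumes "(f has_derivative D) (at x)"
  shows "((\<lambda>t. f (x + t *\<^sub>R axis h 1)) has_vector_derivative D (axis h 1)) (at 0)"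
proof -
  have "((\<lambda>t. x + t *\<^sub>R axis h 1) has_derivative (\<lambda>t. t *\<^sub>R axis h 1)) (at 0)"
    by (auto intro!: derivative_eq_intros)
  from has_derivative_compose[OF this, of f D] assms
  have "((\<lambda>t. f (x + t *\<^sub>R axis h 1)) has_derivative (\<lambda>t. D (t *\<^sub>R axis h 1))) (at 0)"
    by simp
  then show ?thesis
    unfolding has_vector_derivative_def
    using linear_cmul[OF has_derivative_linear[OF assms]] by simp
qed

lemma partial_deriv_eqI:
  "((\<lambda>t. f (x + t *\<^sub>R axis h 1)) has_vector_derivative d) (at 0) \<Longrightarrow> partial_deriv h f x = d"
  unfolding partial_deriv_def by (rule vector_derivative_at)

lemma partial_deriv_has_derivative:
  "(f has_derivative D) (at x) \<Longrightarrow> partial_deriv h f x = D (axis h 1)"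
  by (intro partial_deriv_eqI has_vector_derivative_line)

lemma has_vector_derivative_partial_deriv:
  assumes "f differentiable (at x)"
  shows "((\<lambda>t. f (x + t *\<^sub>R axis h 1)) has_vector_derivative partial_deriv h f x) (at 0)"
  using assms has_vector_derivative_line partial_deriv_has_derivative
  unfolding differentiable_def by metis

lemma C1_funI:
  assumes "\<And>x. (f has_derivative D x) (at x)" "\<And>h. continuous_on UNIV (\<lambda>x. D x (axis h 1))"
  shows "C1_fun f"
proof -
  have "partial_deriv h f = (\<lambda>x. D x (axis h 1))" for h
    using partial_deriv_has_derivative[OF assms(1)] by auto
  then show ?thesis using assms by (auto simp: C1_fun_def differentiable_def)
qed

lemma C1_fun_differentiable: "C1_fun f \<Longrightarrow> f differentiable (at x)"
  by (simp add: C1_fun_def)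

lemma C1_fun_continuous: "C1_fun f \<Longrightarrow> continuous_on UNIV f"
  by (simp add: C1_fun_def continuous_at_imp_continuous_on differentiable_imp_continuous_within)

lemma C1_fun_continuous_partial: "C1_fun f \<Longrightarrow> continuous_on UNIV (partial_deriv h f)"
  by (simp add: C1_fun_def)

lemma
  assumes f: "C1_fun f" and g: "C1_fun g"
  shows partial_deriv_scaleR: "partial_deriv h (\<lambda>x. f x *\<^sub>R g x) x = f x *\<^sub>R partial_deriv h g x + partial_deriv h f x *\<^sub>R g x"
    and C1_fun_scaleR: "C1_fun (\<lambda>x. f x *\<^sub>R g x)"
proof -
  have *: "partial_deriv h (\<lambda>x. f x *\<^sub>R g x) x = f x *\<^sub>R partial_deriv h g x + partial_deriv h f x *\<^sub>R g x" for h x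
    using bounded_bilinear.has_vector_derivative[OF bounded_bilinear_scaleR
        has_vector_derivative_partial_deriv[OF C1_fun_differentiable[OF f, of x], of h]
        has_vector_derivative_partial_deriv[OF C1_fun_differentiable[OF g, of x], of h]]
    by (intro partial_deriv_eqI) simp
  show "partial_deriv h (\<lambda>x. f x *\<^sub>R g x) x = f x *\<^sub>R partial_deriv h g x + partial_deriv h f x *\<^sub>R g x" by (rule *)
  have "partial_deriv h (\<lambda>x. f x *\<^sub>R g x) = (\<lambda>x. f x *\<^sub>R partial_deriv h g x + partial_deriv h f x *\<^sub>R g x)" for h
    using * by auto
  moreover have "(\<lambda>x. f x *\<^sub>R g x) differentiable (at x)" for x
    by (intro differentiable_scaleR C1_fun_differentiable f g)
  ultimately show "C1_fun (\<lambda>x. f x *\<^sub>R g x)"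
    unfolding C1_fun_def using f g
    by (auto intro!: continuous_intros C1_fun_continuous[OF f] C1_fun_continuous[OF g] C1_fun_continuous_partial)
qed

lemma
  assumes f: "C1_fun f" and g: "C1_fun g"
  shows partial_deriv_add: "partial_deriv h (\<lambda>x. f x + g x) x = partial_deriv h f x + partial_deriv h g x"
    and C1_fun_add: "C1_fun (\<lambda>x. f x + g x)"
proof -
  have *: "partial_deriv h (\<lambda>x. f x + g x) x = partial_deriv h f x + partial_deriv h g x" for h x
    by (intro partial_deriv_eqI has_vector_derivative_add has_vector_derivative_partial_deriv C1_fun_differentiable f g)
  show "partial_deriv h (\<lambda>x. f x + g x) x = partial_deriv h f x + partial_deriv h g x" by (rule *)
  have "partial_deriv h (\<lambda>x. f x + g x) = (\<lambda>x. partial_deriv h f x + partial_deriv h g x)" for h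
    using * by auto
  moreover have "(\<lambda>x. f x + g x) differentiable (at x)" for x
    by (intro differentiable_add C1_fun_differentiable f g)
  ultimately show "C1_fun (\<lambda>x. f x + g x)"
    unfolding C1_fun_def using f g
    by (auto intro!: continuous_intros C1_fun_continuous_partial)
qed

lemma C1_fun_bounded_linear: "bounded_linear f \<Longrightarrow> C1_fun f"
  by (rule C1_funI[where D = "\<lambda>_. f"]) (auto intro: bounded_linear_imp_has_derivative)

lemma C1_fun_const: "C1_fun (\<lambda>x. c)"
  by (rule C1_funI[where D = "\<lambda>_ _. 0"]) auto

lemma partial_deriv_const: "partial_deriv h (\<lambda>x. c) x = 0"
  by (rule partial_deriv_eqI) (auto intro!: derivative_eq_intros)

lemma
  assumes g: "\<And>s. (g has_real_derivative g' s) (at s)" and f: "C1_fun f"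
  shows partial_deriv_compose_real: "partial_deriv h (\<lambda>x. g (f x)) x = g' (f x) * partial_deriv h f x"
    and C1_fun_compose_real: "continuous_on UNIV g' \<Longrightarrow> C1_fun (\<lambda>x. g (f x))"
proof -
  have *: "partial_deriv h (\<lambda>x. g (f x)) x = g' (f x) * partial_deriv h f x" for h x
    using DERIV_chain2[OF g has_vector_derivative_partial_deriv[OF C1_fun_differentiable[OF f],
          unfolded has_real_derivative_iff_has_vector_derivative[symmetric]], of x h]
    by (intro partial_deriv_eqI) (simp add: has_real_derivative_iff_has_vector_derivative)
  show "partial_deriv h (\<lambda>x. g (f x)) x = g' (f x) * partial_deriv h f x" by (rule *)
  assume g': "continuous_on UNIV g'"
  have "continuous_on UNIV (\<lambda>x. g' (f x))"
    using continuous_on_compose2[OF g' C1_fun_continuous[OF f]] by simp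
  moreover have "partial_deriv h (\<lambda>x. g (f x)) = (\<lambda>x. g' (f x) * partial_deriv h f x)" for h
    using * by auto
  moreover have "(\<lambda>x. g (f x)) differentiable (at x)" for x
  proof -
    have "g differentiable (at (f x))"
      using g by (auto simp: differentiable_def has_field_derivative_def)
    then show ?thesis
      using differentiable_chain_at[OF C1_fun_differentiable[OF f]] by (simp add: o_def)
  qed
  ultimately show "C1_fun (\<lambda>x. g (f x))"
    unfolding C1_fun_def using f by (auto intro!: continuous_intros C1_fun_continuous_partial)
qed

lemma C1_fun_real_polynomial: "real_polynomial_function p \<Longrightarrow> C1_fun p"
proof (induction rule: real_polynomial_function.induct)
  case (mult f g)
  then show ?case using C1_fun_scaleR[of f g] by simp
qed (auto intro: C1_fun_bounded_linear C1_fun_const C1_fun_add)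

lemma C1_0_I:
  assumes "C1_fun u" "compact K" "K \<subseteq> \<Omega>" "\<And>x. u x \<noteq> 0 \<Longrightarrow> x \<in> K"
  shows "u \<in> C1_0 \<Omega>"
proof -
  have sub: "closure {x. u x \<noteq> 0} \<subseteq> K"
    using assms(2,4) by (intro closure_minimal) (auto simp: compact_imp_closed)
  have "compact (closure {x. u x \<noteq> 0})"
    using compact_Int_closed[OF assms(2) closed_closure, of "{x. u x \<noteq> 0}"] sub
    by (simp add: Int_absorb1)
  then show ?thesis using assms(1,3) sub by (auto simp: C1_0_def C1_fun_def)
qed

lemma C1_0_differentiable: "u \<in> C1_0 \<Omega> \<Longrightarrow> u differentiable (at x)"
  by (simp add: C1_0_def)

text \<open>For \<open>q = 2\<close> the weighted function is \<open>u\<close> itself, but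
  \<open>lp_deriv\<close> returns 0 at the zeros of \<open>u\<close>, because
  \<open>0 powr 0 = 0\<close>; hence the condition \<open>nz\<close>.\<close>

lemma partial_deriv_norm_powr_scaleR:
  fixes u :: "real ^ 'n \<Rightarrow> 'b::real_inner"
  assumes q: "2 \<le> q" and u: "u differentiable (at x)" and nz: "q = 2 \<longrightarrow> u x \<noteq> 0"
  shows "((\<lambda>t. norm (u (x + t *\<^sub>R axis h 1)) powr (q - 2) *\<^sub>R u (x + t *\<^sub>R axis h 1))
      has_vector_derivative lp_deriv q (u x) (partial_deriv h u x)) (at 0)"
proof (cases "q = 2")
  case True
  have "norm (u y) powr (q - 2) *\<^sub>R u y = u y" for y
    using True by (cases "u y = 0") auto
  then show ?thesis
    using has_vector_derivative_partial_deriv[OF u] nz True by (simp add: lp_deriv_def)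
next
  case False
  then show ?thesis
    using q has_vector_derivative_norm_powr_scaleR[OF _ has_vector_derivative_partial_deriv[OF u], of q h]
    by simp
qed

section \<open>Sufficiency of the eigenvalue condition\<close>

definition Re_vec :: "complex ^ 'm \<Rightarrow> real ^ 'm" where "Re_vec z = (\<chi> i. Re (z $ i))"
definition Im_vec :: "complex ^ 'm \<Rightarrow> real ^ 'm" where "Im_vec z = (\<chi> i. Im (z $ i))"

text \<open>The inner product of \<open>complex ^ 'm\<close> is that of the underlying real space,
  so the real parts in the definition of dissipativity become real scalar products.\<close>

lemma Re_herm_prod: "Re (herm_prod x y) = x \<bullet> y"
  by (simp add: herm_prod_def inner_vec_def inner_complex_def)

lemma inner_Re_Im_vec: "x \<bullet> y = Re_vec x \<bullet> Re_vec y + Im_vec x \<bullet> Im_vec y"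
  by (simp add: inner_vec_def inner_complex_def Re_vec_def Im_vec_def sum.distrib)

lemma Re_vec_of_real_matrix: "Re_vec (map_matrix complex_of_real M *v z) = M *v Re_vec z"
  by (simp add: vec_eq_iff Re_vec_def matrix_vector_mult_def map_matrix_def)

lemma Im_vec_of_real_matrix: "Im_vec (map_matrix complex_of_real M *v z) = M *v Im_vec z"
  by (simp add: vec_eq_iff Im_vec_def matrix_vector_mult_def map_matrix_def)

text \<open>Q mixes the real and imaginary parts of \<open>u\<close> and \<open>d\<close>, but the
  eigenvalue enclosure is additive over the two parts of \<open>d\<close>. It thus carries over to
  complex vectors, where \<open>dissipation_form_nonneg\<close> applies. The first conclusion serves
  \<open>q = 2\<close>, where \<open>lp_deriv\<close> may fail to be the derivative.\<close>

lemma eigenvalue_condition_sufficient: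
  fixes M :: "real ^ 'm ^ 'm" and u d :: "complex ^ 'm"
  assumes q: "2 \<le> q" and sym: "transpose M = M" and psd: "\<And>x. 0 \<le> (M *v x) \<bullet> x"
    and cond: "(1/2 - 1/q)\<^sup>2 * (min_eigenvalue M + max_eigenvalue M)\<^sup>2
        \<le> min_eigenvalue M * max_eigenvalue M"
  shows "0 \<le> (map_matrix complex_of_real M *v d) \<bullet> d"
    and "0 \<le> (map_matrix complex_of_real M *v d) \<bullet> lp_deriv q u d"
proof -
  let ?M = "map_matrix complex_of_real M"
  let ?a = "min_eigenvalue M" and ?b = "max_eigenvalue M"
  show "0 \<le> (?M *v d) \<bullet> d"
    by (simp add: inner_Re_Im_vec Re_vec_of_real_matrix Im_vec_of_real_matrix psd)
  have "(norm (?M *v d))\<^sup>2 + ?a * ?b * (norm d)\<^sup>2 \<le> (?a + ?b) * ((?M *v d) \<bullet> d)"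
    using add_mono[OF eigenvalue_enclosure[OF sym, of "Re_vec d"] eigenvalue_enclosure[OF sym, of "Im_vec d"]]
    unfolding power2_norm_eq_inner inner_Re_Im_vec[of d] inner_Re_Im_vec[of "?M *v d"]
      Re_vec_of_real_matrix Im_vec_of_real_matrix
    by (simp add: algebra_simps)
  then have "0 \<le> (norm u)\<^sup>2 * ((?M *v d) \<bullet> d) + (q - 2) * ((u \<bullet> d) * (u \<bullet> (?M *v d)))"
    using dissipation_form_nonneg[OF q psd_eigenvalues_nonneg[OF sym psd] cond] by blast
  then show "0 \<le> (?M *v d) \<bullet> lp_deriv q u d"
    by (cases "u = 0") (simp_all add: lp_deriv_form, simp add: lp_deriv_def)
qed

lemma of_real_matrix_symmetric:
  fixes M :: "real ^ 'm ^ 'm"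
  assumes "transpose M = M"
  shows "(map_matrix complex_of_real M *v x) \<bullet> y = (map_matrix complex_of_real M *v y) \<bullet> x"
  unfolding inner_Re_Im_vec Re_vec_of_real_matrix Im_vec_of_real_matrix
  using symmetric_matrix_inner[OF assms, of "Re_vec x" "Re_vec y"]
    symmetric_matrix_inner[OF assms, of "Im_vec x" "Im_vec y"]
  by (simp add: inner_commute)

text \<open>If the function is not integrable, its integral is 0 by convention and the bound still
  holds.\<close>

lemma Re_set_lebesgue_integral_nonneg:
  fixes f :: "'a \<Rightarrow> complex"
  assumes "AE x\<in>S in M. 0 \<le> Re (f x)"
  shows "0 \<le> Re (LINT x:S|M. f x)"
proof (cases "integrable M (\<lambda>x. indicator S x *\<^sub>R f x)")
  case True
  have "Re (LINT x:S|M. f x) = (LINT x|M. Re (indicator S x *\<^sub>R f x))"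
    unfolding set_lebesgue_integral_def using True by (rule integral_Re[symmetric])
  also have "\<dots> \<ge> 0"
    using assms by (intro integral_nonneg_AE) (auto simp: indicator_def)
  finally show ?thesis .
qed (simp add: set_lebesgue_integral_def not_integrable_integral_eq)

text \<open>The second value is the one for \<open>q = 2\<close>, where the weight disappears. Since
  \<open>eigenvalue_condition_sufficient\<close> treats both values, the zeros of \<open>u\<close>
  need no separate argument.\<close>

lemma partial_deriv_norm_powr_weighted:
  fixes u :: "real ^ 'n \<Rightarrow> 'b::real_inner"
  assumes q: "2 \<le> q" and u: "u differentiable (at x)"
  shows "partial_deriv h (\<lambda>x. norm (u x) powr (q - 2) *\<^sub>R u x) x
    \<in> {lp_deriv q (u x) (partial_deriv h u x), partial_deriv h u x}"
proof (cases "q = 2")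
  case True
  have "norm (u y) powr (q - 2) *\<^sub>R u y = u y" for y
    using True by (cases "u y = 0") auto
  then show ?thesis by simp
next
  case False
  then show ?thesis
    using partial_deriv_eqI[OF partial_deriv_norm_powr_scaleR[OF q u]] by simp
qed

text \<open>The two reciprocals add up to 1, so the conjugate exponent only changes the sign of the
  difference.\<close>

lemma conjugate_exponent_half_diff:
  fixes p :: real
  assumes "1 < p"
  shows "(1/2 - 1/(p / (p - 1)))\<^sup>2 = (1/2 - 1/p)\<^sup>2"
proof -
  have "1/2 - 1/(p / (p - 1)) = - (1/2 - 1/p)" using assms by (simp add: field_simps)
  then show ?thesis by (metis power2_minus)
qed

text \<open>The integrand has nonnegative real part at almost every point of
  \<open>\<Omega>\<close>. For \<open>p < 2\<close> the weighted function is the first argument of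
  the form; symmetry of the matrices reduces this to the other order.\<close>

lemma Lp_dissipative_if_eigenvalue_condition:
  fixes \<Omega> :: "(real ^ 'n) set"
    and A :: "'n \<Rightarrow> real ^ 'n \<Rightarrow> real ^ 'm ^ 'm"
  assumes p: "1 < p"
    and sym: "AE x\<in>\<Omega> in lebesgue. \<forall>h. transpose (A h x) = A h x"
    and psd: "AE x\<in>\<Omega> in lebesgue. \<forall>h. \<forall>\<xi> :: real ^ 'm. (A h x *v \<xi>) \<bullet> \<xi> \<ge> 0"
    and cond: "AE x\<in>\<Omega> in lebesgue. \<forall>h.
      (1/2 - 1/p)\<^sup>2 * (min_eigenvalue (A h x) + max_eigenvalue (A h x))\<^sup>2
                 \<le> min_eigenvalue (A h x) * max_eigenvalue (A h x)"
  shows "Lp_dissipative p A \<Omega>"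
proof -
  define q where "q = (if p \<ge> 2 then p else p / (p - 1))"
  have q: "2 \<le> q" using p by (auto simp: q_def field_simps)
  have eq: "(1/2 - 1/q)\<^sup>2 = (1/2 - 1/p)\<^sup>2"
    using conjugate_exponent_half_diff[OF p] unfolding q_def by (cases "p \<ge> 2") (simp_all only: if_True if_False)
  let ?v = "\<lambda>u x. norm (u x) powr (q - 2) *\<^sub>R u x"
  let ?M = "\<lambda>h x. map_matrix complex_of_real (A h x)"
  have ae: "AE x\<in>\<Omega> in lebesgue. \<forall>h. 0 \<le> (?M h x *v partial_deriv h u x) \<bullet> partial_deriv h (?v u) x
      \<and> (?M h x *v partial_deriv h (?v u) x) \<bullet> partial_deriv h u x = (?M h x *v partial_deriv h u x) \<bullet> partial_deriv h (?v u) x"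
    if u: "u \<in> C1_0 \<Omega>" for u :: "real ^ 'n \<Rightarrow> complex ^ 'm"
    using sym psd cond
  proof eventually_elim
    case (elim x)
    show ?case
    proof (intro impI allI conjI)
      fix h assume x: "x \<in> \<Omega>"
      have s: "transpose (A h x) = A h x" using elim x by blast
      then show "(?M h x *v partial_deriv h (?v u) x) \<bullet> partial_deriv h u x = (?M h x *v partial_deriv h u x) \<bullet> partial_deriv h (?v u) x"
        by (rule of_real_matrix_symmetric)
      show "0 \<le> (?M h x *v partial_deriv h u x) \<bullet> partial_deriv h (?v u) x"
        using partial_deriv_norm_powr_weighted[OF q C1_0_differentiable[OF u], of h x]
          eigenvalue_condition_sufficient(1)[OF q s, of "partial_deriv h u x"]
          eigenvalue_condition_sufficient(2)[OF q s, of "partial_deriv h u x" "u x"] elim x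
        unfolding eq by auto
    qed
  qed
  have "0 \<le> Re (sesq_form A \<Omega> u (?v u))" "0 \<le> Re (sesq_form A \<Omega> (?v u) u)"
    if u: "u \<in> C1_0 \<Omega>" for u :: "real ^ 'n \<Rightarrow> complex ^ 'm"
    unfolding sesq_form_def using ae[OF u]
    by (auto intro!: Re_set_lebesgue_integral_nonneg elim!: eventually_mono sum_nonneg simp: Re_herm_prod sum_nonneg)
  then show ?thesis unfolding Lp_dissipative_def q_def by (auto simp: Let_def)
qed

section \<open>Approximation of indicator functions\<close>

text \<open>The outer square makes the positive part C^1 across the sphere of radius
  \<open>r\<close>.\<close>

definition bump :: "real ^ 'n \<Rightarrow> real \<Rightarrow> real ^ 'n \<Rightarrow> real" where
  "bump c r x = (max 0 (r\<^sup>2 - (norm (x - c))\<^sup>2))\<^sup>2"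

lemma has_real_derivative_max_0_square:
  "((\<lambda>s. (max 0 s)\<^sup>2) has_real_derivative 2 * max 0 s) (at (s::real))"
proof -
  consider "s < 0" | "s = 0" | "0 < s" by linarith
  then show ?thesis
  proof cases
    case 1
    have "((\<lambda>s. 0) has_real_derivative 2 * max 0 s) (at s)" using 1 by simp
    then show ?thesis
      by (rule has_field_derivative_transform_within_open[where S = "{..<0}"]) (use 1 in auto)
  next
    case 2
    have "((\<lambda>h. max 0 h * sgn h * (max 0 h / \<bar>h\<bar>)) \<longlongrightarrow> 0) (at (0::real))"
    proof (rule Lim_null_comparison)
      show "\<forall>\<^sub>F h in at 0. norm (max 0 h * sgn h * (max 0 h / \<bar>h\<bar>)) \<le> \<bar>h :: real\<bar>"
        by (intro always_eventually) (auto simp: max_def abs_mult sgn_if)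
      show "((\<lambda>h. \<bar>h :: real\<bar>) \<longlongrightarrow> 0) (at 0)"
        by (intro tendsto_eq_intros) auto
    qed
    moreover have "(max 0 h)\<^sup>2 / h = max 0 h * sgn h * (max 0 h / \<bar>h\<bar>)" for h :: real
      by (auto simp: max_def power2_eq_square sgn_if)
    ultimately show ?thesis using 2 by (simp add: DERIV_def)
  next
    case 3
    have "((\<lambda>s. s\<^sup>2) has_real_derivative 2 * max 0 s) (at s)"
      using 3 by (auto intro!: derivative_eq_intros)
    then show ?thesis
      by (rule has_field_derivative_transform_within_open[where S = "{0<..}"]) (use 3 in auto)
  qed
qed

lemma C1_fun_bump: "C1_fun (bump c r)"
proof -
  have "C1_fun (\<lambda>x. r\<^sup>2 - (norm (x - c))\<^sup>2)"
    unfolding power2_norm_eq_inner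
    by (rule C1_funI[where D = "\<lambda>x h. - (2 * ((x - c) \<bullet> h))"])
      (auto intro!: derivative_eq_intros continuous_intros simp: inner_commute)
  then show ?thesis
    unfolding bump_def
    by (rule C1_fun_compose_real[OF has_real_derivative_max_0_square]) (intro continuous_intros)
qed

lemma bump_nonneg: "0 \<le> bump c r x"
  by (simp add: bump_def)

lemma bump_pos: "x \<in> ball c r \<Longrightarrow> 0 < bump c r x"
  using power_strict_mono[of "norm (x - c)" r 2]
  by (simp add: bump_def dist_norm norm_minus_commute max_def)

lemma bump_eq_0: "x \<notin> cball c r \<Longrightarrow> 0 \<le> r \<Longrightarrow> bump c r x = 0"
  using power_mono[of r "norm (x - c)" 2]
  by (simp add: bump_def dist_norm norm_minus_commute max_def)

lemma bump_le: "bump c r x \<le> r ^ 4"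
proof -
  have "(max 0 (r\<^sup>2 - (norm (x - c))\<^sup>2))\<^sup>2 \<le> (r\<^sup>2)\<^sup>2"
    by (intro power_mono) auto
  then show ?thesis by (simp add: bump_def)
qed

lemma borel_measurable_lebesgue_continuous:
  fixes f :: "'a::euclidean_space \<Rightarrow> 'b::topological_space"
  assumes "continuous_on UNIV f"
  shows "f \<in> borel_measurable lebesgue"
  using borel_measurable_continuous_onI[OF assms] by (simp add: measurable_completion)

text \<open>Measurability gives continuous functions that converge almost everywhere; they are
  truncated to [0, 1] and approximated on \<open>K\<close> by polynomials with error below 1/(n +
  1). The truncation yields the bound 2 for dominated convergence.\<close>

lemma C1_fun_approx_indicator:
  fixes E :: "(real ^ 'n) set"
  assumes E: "E \<in> sets lebesgue" and K: "compact K"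
  obtains p where "\<And>n. C1_fun (p n :: real ^ 'n \<Rightarrow> real)" "\<And>n x. x \<in> K \<Longrightarrow> \<bar>p n x\<bar> \<le> 2"
    "AE x in lebesgue. x \<in> K \<longrightarrow> (\<lambda>n. p n x) \<longlonglongrightarrow> indicator E x"
proof -
  obtain N g where N: "negligible N" and g: "\<And>n. continuous_on UNIV (g n)"
    and lim: "\<And>x. x \<notin> N \<Longrightarrow> (\<lambda>n. g n x) \<longlonglongrightarrow> indicat_real E x"
    using indicator_measurable_on[OF E] unfolding measurable_on_def by auto
  define g' where "g' n x = max 0 (min 1 (g n x))" for n x
  have g': "continuous_on K (g' n)" for n
    unfolding g'_def by (intro continuous_intros continuous_on_subset[OF g]) auto
  have "\<exists>p. real_polynomial_function p \<and> (\<forall>x\<in>K. \<bar>g' n x - p x\<bar> < inverse (real (Suc n)))" for n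
    by (rule Stone_Weierstrass_real_polynomial_function[OF K g', of "inverse (real (Suc n))" n]) auto
  then obtain p where p: "\<And>n. real_polynomial_function (p n)"
    and close: "\<And>n x. x \<in> K \<Longrightarrow> \<bar>g' n x - p n x\<bar> < inverse (real (Suc n))"
    by metis
  show thesis
  proof
    show "C1_fun (p n)" for n by (rule C1_fun_real_polynomial[OF p])
    show "\<bar>p n x\<bar> \<le> 2" if "x \<in> K" for n x
    proof -
      have "inverse (real (Suc n)) \<le> 1" by (simp add: field_simps)
      moreover have "0 \<le> g' n x" "g' n x \<le> 1" by (auto simp: g'_def)
      ultimately show ?thesis using close[OF that, of n] by linarith
    qed
    have "(\<lambda>n. p n x) \<longlonglongrightarrow> indicator E x" if x: "x \<notin> N" "x \<in> K" for x
    proof -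
      have "(\<lambda>n. g' n x) \<longlonglongrightarrow> max 0 (min 1 (indicator E x))"
        unfolding g'_def by (intro tendsto_intros lim x)
      moreover have "max 0 (min 1 (indicator E x)) = indicat_real E x" by (simp add: indicator_def)
      moreover have "(\<lambda>n. g' n x - p n x) \<longlonglongrightarrow> 0"
        by (rule Lim_null_comparison[OF _ LIMSEQ_inverse_real_of_nat])
          (use close[OF x(2)] in \<open>auto intro!: always_eventually less_imp_le\<close>)
      ultimately show ?thesis using tendsto_diff[of "\<lambda>n. g' n x" _ _ "\<lambda>n. g' n x - p n x" 0] by fastforce
    qed
    then show "AE x in lebesgue. x \<in> K \<longrightarrow> (\<lambda>n. p n x) \<longlonglongrightarrow> indicator E x"
      by (intro AE_I'[of N]) (use N in \<open>auto simp: negligible_iff_null_sets\<close>)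
  qed
qed

section \<open>Nonnegativity from test integrals\<close>

lemma locally_integrable_on_indicator:
  assumes "f locally_integrable_on \<Omega>" "compact K" "K \<subseteq> \<Omega>"
  shows "integrable lebesgue (\<lambda>x. indicator K x * f x :: real)"
  using assms unfolding locally_integrable_on_def set_integrable_def by simp

text \<open>Testing with \<open>bump\<close> times approximants of the indicator of
  \<open>E\<close>, the set where \<open>F\<close> is negative, shows in the limit that the integral
  of F bump^q over \<open>E\<close> is nonnegative. Inside the ball this integrand is negative on
  \<open>E\<close>, so \<open>E\<close> is null there.\<close>

lemma AE_nonneg_on_ball:
  fixes f :: "real ^ 'n \<Rightarrow> real"
  assumes q: "0 < q" and r: "0 < r" and f: "integrable lebesgue (\<lambda>x. indicator (cball c r) x * f x)"
    and test: "\<And>\<phi> :: real ^ 'n \<Rightarrow> real. C1_fun \<phi> \<Longrightarrow> (\<And>x. x \<notin> cball c r \<Longrightarrow> \<phi> x = 0) \<Longrightarrow>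
        0 \<le> (LINT x|lebesgue. (indicator (cball c r) x * f x) * \<bar>\<phi> x\<bar> powr q)"
  shows "AE x in lebesgue. x \<in> ball c r \<longrightarrow> 0 \<le> f x"
proof -
  let ?K = "cball c r"
  define F where "F = (\<lambda>x. indicator ?K x * f x)"
  have F: "integrable lebesgue F" using f by (simp add: F_def)
  have Fm[measurable]: "F \<in> borel_measurable lebesgue" using F by (rule borel_measurable_integrable)
  define E where "E = {x. F x < 0}"
  have E[measurable]: "E \<in> sets lebesgue"
    using measurable_sets[OF Fm, of "{..<0}"] by (simp add: E_def vimage_def)
  obtain p where p: "\<And>n. C1_fun (p n :: real ^ 'n \<Rightarrow> real)" "\<And>n x. x \<in> ?K \<Longrightarrow> \<bar>p n x\<bar> \<le> 2"
    and lim: "AE x in lebesgue. x \<in> ?K \<longrightarrow> (\<lambda>n. p n x) \<longlonglongrightarrow> indicator E x"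
    using C1_fun_approx_indicator[OF E compact_cball] by blast
  have bm[measurable]: "bump c r \<in> borel_measurable lebesgue"
    by (intro borel_measurable_lebesgue_continuous C1_fun_continuous C1_fun_bump)
  have pm[measurable]: "p n \<in> borel_measurable lebesgue" for n
    by (intro borel_measurable_lebesgue_continuous C1_fun_continuous p)
  have "(\<lambda>n. LINT x|lebesgue. F x * \<bar>bump c r x * p n x\<bar> powr q)
      \<longlonglongrightarrow> (LINT x|lebesgue. F x * \<bar>bump c r x * indicator E x\<bar> powr q)"
  proof (rule integral_dominated_convergence[where w = "\<lambda>x. \<bar>F x\<bar> * (r ^ 4 * 2) powr q"])
    show "integrable lebesgue (\<lambda>x. \<bar>F x\<bar> * (r ^ 4 * 2) powr q)"
      using F by (intro integrable_mult_left integrable_abs)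
    show "AE x in lebesgue. (\<lambda>n. F x * \<bar>bump c r x * p n x\<bar> powr q)
        \<longlonglongrightarrow> F x * \<bar>bump c r x * indicator E x\<bar> powr q"
      using lim
    proof eventually_elim
      case (elim x)
      show ?case
      proof (cases "x \<in> ?K")
        case True
        have "(\<lambda>n. \<bar>bump c r x * p n x\<bar>) \<longlonglongrightarrow> \<bar>bump c r x * indicator E x\<bar>"
          using elim True by (intro tendsto_intros) auto
        then show ?thesis
          using q by (intro tendsto_mult tendsto_const tendsto_powr') (auto intro: always_eventually)
      qed (simp add: F_def)
    qed
    show "AE x in lebesgue. norm (F x * \<bar>bump c r x * p n x\<bar> powr q) \<le> \<bar>F x\<bar> * (r ^ 4 * 2) powr q" for n
    proof (rule AE_I2)
      fix x :: "real ^ 'n"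
      show "norm (F x * \<bar>bump c r x * p n x\<bar> powr q) \<le> \<bar>F x\<bar> * (r ^ 4 * 2) powr q"
      proof (cases "x \<in> ?K")
        case True
        have "\<bar>bump c r x * p n x\<bar> \<le> r ^ 4 * 2"
          unfolding abs_mult using bump_le[of c r x] bump_nonneg[of c r x] p(2)[OF True, of n]
          by (intro mult_mono) auto
        then show ?thesis
          using q by (auto simp: abs_mult intro!: mult_left_mono powr_mono2)
      qed (simp add: F_def)
    qed
  qed measurable
  moreover have "0 \<le> (LINT x|lebesgue. F x * \<bar>bump c r x * p n x\<bar> powr q)" for n
    unfolding F_def
    using test[of "\<lambda>x. bump c r x * p n x"] C1_fun_scaleR[OF C1_fun_bump p(1), of c r n] bump_eq_0[of _ c r] r
    by auto
  ultimately have "0 \<le> (LINT x|lebesgue. F x * \<bar>bump c r x * indicator E x\<bar> powr q)"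
    by (intro LIMSEQ_le_const) auto
  \<comment> \<open>The limit integrand is nonpositive, so \<open>G\<close> is nonnegative with
    integral at most 0 and vanishes almost everywhere.\<close>
  moreover define G where "G = (\<lambda>x. - (F x * \<bar>bump c r x * indicator E x\<bar> powr q))"
  moreover have G0: "0 \<le> G x" for x
    by (auto simp: G_def E_def indicator_def mult_nonpos_nonneg)
  moreover have Gi: "integrable lebesgue G"
    unfolding G_def
  proof (rule Bochner_Integration.integrable_minus,
      rule Bochner_Integration.integrable_bound[where f = "\<lambda>x. F x * (r ^ 4) powr q"])
    show "integrable lebesgue (\<lambda>x. F x * (r ^ 4) powr q)" using F by (rule integrable_mult_left)
    show "AE x in lebesgue. norm (F x * \<bar>bump c r x * indicator E x\<bar> powr q) \<le> norm (F x * (r ^ 4) powr q)"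
      using q bump_le[of c r] bump_nonneg[of c r]
      by (intro AE_I2) (auto simp: abs_mult indicator_def intro!: mult_left_mono powr_mono2)
  qed measurable
  ultimately have "integral\<^sup>L lebesgue G = 0"
    using integral_nonneg_AE[of G lebesgue] by (simp add: G_def)
  then have "AE x in lebesgue. G x = 0"
    using integral_nonneg_eq_0_iff_AE[OF Gi] G0 by simp
  then show ?thesis
  proof eventually_elim
    case (elim x)
    show ?case
    proof (intro impI, rule ccontr)
      assume x: "x \<in> ball c r" and "\<not> 0 \<le> f x"
      then have "x \<in> E" "F x < 0" by (auto simp: E_def F_def indicator_def)
      then show False using elim bump_pos[OF x] q by (auto simp: G_def)
    qed
  qed
qed

text \<open>Negligibility is a local property, which reduces the claim to closed balls inside
  \<open>\<Omega>\<close>.\<close>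

lemma AE_nonneg_if_test_integrals_nonneg:
  fixes f :: "real ^ 'n \<Rightarrow> real"
  assumes q: "0 < q" and \<Omega>: "open \<Omega>" and f: "f locally_integrable_on \<Omega>"
    and test: "\<And>K \<phi>. compact K \<Longrightarrow> K \<subseteq> \<Omega> \<Longrightarrow> C1_fun \<phi> \<Longrightarrow> (\<And>x. x \<notin> K \<Longrightarrow> \<phi> x = 0) \<Longrightarrow>
        0 \<le> (LINT x|lebesgue. (indicator K x * f x) * \<bar>\<phi> x\<bar> powr q)"
  shows "AE x\<in>\<Omega> in lebesgue. 0 \<le> f x"
proof -
  have "negligible {x \<in> \<Omega>. f x < 0}"
  proof (intro iffD2[OF locally_negligible_alt] ballI)
    fix c assume c: "c \<in> {x \<in> \<Omega>. f x < 0}"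
    then obtain r where r: "r > 0" "cball c r \<subseteq> \<Omega>" using \<Omega> open_contains_cball by blast
    have "AE x in lebesgue. x \<in> ball c r \<longrightarrow> 0 \<le> f x"
      by (rule AE_nonneg_on_ball[OF q r(1) locally_integrable_on_indicator[OF f _ r(2)] test])
        (use r in auto)
    then obtain N where "N \<in> null_sets lebesgue" "\<And>x. x \<notin> N \<Longrightarrow> x \<in> ball c r \<longrightarrow> 0 \<le> f x"
      by (auto elim: AE_E3)
    then have "negligible ({x \<in> \<Omega>. f x < 0} \<inter> ball c r)"
      unfolding negligible_iff_null_sets[symmetric]
      by (elim negligible_subset) force
    then show "\<exists>U. openin (top_of_set {x \<in> \<Omega>. f x < 0}) U \<and> c \<in> U \<and> negligible U"
      using c r by (intro exI[of _ "{x \<in> \<Omega>. f x < 0} \<inter> ball c r"]) auto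
  qed
  then show ?thesis
    by (intro AE_I'[of "{x \<in> \<Omega>. f x < 0}"]) (auto simp: negligible_iff_null_sets)
qed

section \<open>Oscillating test functions\<close>

text \<open>The bound on \<open>F\<close> is required only where \<open>B\<close> is nonzero:
  \<open>B\<close> will carry the indicator of a compact set, on which continuous data are
  bounded.\<close>

lemma
  fixes B F :: "'a \<Rightarrow> real"
  assumes B: "integrable M B" and F: "F \<in> borel_measurable M"
    and bound: "\<And>x. B x \<noteq> 0 \<Longrightarrow> \<bar>F x\<bar> \<le> C"
  shows integrable_mult_bounded: "integrable M (\<lambda>x. B x * F x)"
    and abs_mult_bounded_le: "\<bar>B x * F x\<bar> \<le> \<bar>B x\<bar> * C"
proof -
  have le: "\<bar>B x * F x\<bar> \<le> \<bar>B x\<bar> * C" for x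
    using bound[of x] by (cases "B x = 0") (auto simp: abs_mult intro: mult_left_mono)
  then show "\<bar>B x * F x\<bar> \<le> \<bar>B x\<bar> * C" .
  have [measurable]: "F \<in> borel_measurable M" "B \<in> borel_measurable M" using F B by auto
  show "integrable M (\<lambda>x. B x * F x)"
  proof (rule Bochner_Integration.integrable_bound)
    show "integrable M (\<lambda>x. \<bar>B x\<bar> * C)" using B by (intro integrable_mult_left integrable_abs)
    show "AE x in M. norm (B x * F x) \<le> norm (\<bar>B x\<bar> * C)"
      using order.trans[OF le abs_ge_self] by (intro AE_I2) simp
  qed measurable
qed

lemma tendsto_integral_mult_bounded:
  fixes B :: "'a \<Rightarrow> real" and F :: "nat \<Rightarrow> 'a \<Rightarrow> real"
  assumes B: "integrable M B" and F: "\<And>n. F n \<in> borel_measurable M" "F' \<in> borel_measurable M"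
    and bound: "\<And>n x. B x \<noteq> 0 \<Longrightarrow> \<bar>F n x\<bar> \<le> C"
    and lim: "\<And>x. (\<lambda>n. F n x) \<longlonglongrightarrow> F' x"
  shows "(\<lambda>n. LINT x|M. B x * F n x) \<longlonglongrightarrow> (LINT x|M. B x * F' x)"
proof (rule integral_dominated_convergence)
  have [measurable]: "B \<in> borel_measurable M" using B by auto
  note F[measurable]
  show "(\<lambda>x. B x * F n x) \<in> borel_measurable M" "(\<lambda>x. B x * F' x) \<in> borel_measurable M" for n
    by measurable
  show "integrable M (\<lambda>x. \<bar>B x\<bar> * C)" using B by (intro integrable_mult_left integrable_abs)
  show "AE x in M. norm (B x * F n x) \<le> \<bar>B x\<bar> * C" for n
    using abs_mult_bounded_le[OF B F(1)[of n] bound] by simp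
  show "AE x in M. (\<lambda>n. B x * F n x) \<longlonglongrightarrow> B x * F' x"
    by (intro AE_I2 tendsto_mult tendsto_const lim)
qed

text \<open>The factor \<open>c\<close> is merely bounded; it will be a value of an oscillating
  function that has no limit.\<close>

lemma tendsto_bounded_times_null:
  fixes c y :: "nat \<Rightarrow> real"
  assumes "\<And>n. \<bar>c n\<bar> \<le> 1" "y \<longlonglongrightarrow> 0"
  shows "(\<lambda>n. c n * y n) \<longlonglongrightarrow> 0"
proof (rule Lim_null_comparison[OF _ tendsto_norm_zero[OF assms(2)]])
  show "\<forall>\<^sub>F n in sequentially. norm (c n * y n) \<le> norm (y n)"
    using assms(1) by (intro always_eventually) (auto simp: abs_mult mult_left_le_one_le)
qed

text \<open>The integrand is linear in these entries, with the locally integrable entries of the matrices as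
  coefficients; so dominated convergence only needs bounds and limits of the entries.\<close>

definition lp_tensor :: "real \<Rightarrow> real ^ 'm \<Rightarrow> real ^ 'm \<Rightarrow> 'm \<Rightarrow> 'm \<Rightarrow> real" where
  "lp_tensor q u d a b = d $ b * lp_deriv q u d $ a"

lemma lp_tensor_scaleR: "lp_tensor q u (s *\<^sub>R d) a b = s\<^sup>2 * lp_tensor q u d a b"
  by (simp add: lp_tensor_def lp_deriv_scaleR power2_eq_square)

lemma lp_tensor_0: "lp_tensor q 0 d a b = 0"
  by (simp add: lp_tensor_def lp_deriv_def)

lemma abs_lp_tensor_le:
  assumes "2 \<le> q"
  shows "\<bar>lp_tensor q u d a b\<bar> \<le> (q - 1) * norm u powr (q - 2) * (norm d)\<^sup>2"
proof -
  have "\<bar>lp_tensor q u d a b\<bar> \<le> norm d * ((q - 1) * norm u powr (q - 2) * norm d)"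
    unfolding lp_tensor_def abs_mult
    by (intro mult_mono component_le_norm_cart order.trans[OF component_le_norm_cart norm_lp_deriv_le[OF assms]]) auto
  then show ?thesis by (simp add: power2_eq_square mult_ac)
qed

lemma borel_measurable_lp_tensor:
  assumes "continuous_on UNIV u" "continuous_on UNIV d"
  shows "(\<lambda>x. lp_tensor q (u x) (d x) a b) \<in> borel_measurable lebesgue"
proof -
  have [measurable]: "u \<in> borel_measurable lebesgue" "d \<in> borel_measurable lebesgue"
    using assms by (auto intro: borel_measurable_lebesgue_continuous)
  have [measurable]: "(\<lambda>v :: real ^ 'b. v $ i) \<in> borel_measurable borel" for i
    by (intro borel_measurable_continuous_onI continuous_intros)
  show ?thesis unfolding lp_tensor_def lp_deriv_def by measurable
qed

text \<open>In the expansion over the direction c d + r, every term but the leading one contains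
  \<open>r\<close> and tends to 0; in the leading one \<open>u\<close> may be replaced by its limit,
  as \<open>lp_deriv\<close> is continuous off 0. A difference is estimated because
  \<open>(c n)\<^sup>2\<close> need not converge.\<close>

lemma lp_tensor_oscillation_limit:
  fixes u r :: "nat \<Rightarrow> real ^ 'm"
  assumes u: "u \<longlonglongrightarrow> u0" "u0 \<noteq> 0" and r: "r \<longlonglongrightarrow> 0" and c: "\<And>n. \<bar>c n\<bar> \<le> 1"
  shows "(\<lambda>n. lp_tensor q (u n) (c n *\<^sub>R d + r n) a b - (c n)\<^sup>2 * lp_tensor q u0 d a b) \<longlonglongrightarrow> 0"
proof -
  have c2: "\<bar>(c n)\<^sup>2\<bar> \<le> 1" for n using c[of n] by (simp add: abs_square_le_1)
  have L: "(\<lambda>n. lp_deriv q (u n) d $ a) \<longlonglongrightarrow> lp_deriv q u0 d $ a"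
    by (intro tendsto_intros tendsto_lp_deriv u)
  have R: "(\<lambda>n. lp_deriv q (u n) (r n) $ a) \<longlonglongrightarrow> 0"
    using tendsto_vec_nth[OF tendsto_lp_deriv[OF u(1) r u(2), of q], of a] by (simp add: lp_deriv_def)
  have rb: "(\<lambda>n. r n $ b) \<longlonglongrightarrow> 0" using tendsto_vec_nth[OF r, of b] by simp
  have "(\<lambda>n. (c n)\<^sup>2 * (d $ b * (lp_deriv q (u n) d $ a - lp_deriv q u0 d $ a))) \<longlonglongrightarrow> 0"
    by (intro tendsto_bounded_times_null c2 tendsto_mult_right_zero) (use L in \<open>simp add: LIM_zero\<close>)
  moreover have "(\<lambda>n. c n * (d $ b * lp_deriv q (u n) (r n) $ a)) \<longlonglongrightarrow> 0"
    by (intro tendsto_bounded_times_null c tendsto_mult_right_zero R)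
  moreover have "(\<lambda>n. c n * (r n $ b * lp_deriv q (u n) d $ a)) \<longlonglongrightarrow> 0"
    by (rule tendsto_bounded_times_null[OF c]) (use tendsto_mult[OF rb L] in simp)
  moreover have "(\<lambda>n. r n $ b * lp_deriv q (u n) (r n) $ a) \<longlonglongrightarrow> 0"
    using tendsto_mult[OF rb R] by simp
  ultimately have "(\<lambda>n. (c n)\<^sup>2 * (d $ b * (lp_deriv q (u n) d $ a - lp_deriv q u0 d $ a))
     + c n * (d $ b * lp_deriv q (u n) (r n) $ a) + c n * (r n $ b * lp_deriv q (u n) d $ a)
     + r n $ b * lp_deriv q (u n) (r n) $ a) \<longlonglongrightarrow> 0 + 0 + 0 + 0"
    by (intro tendsto_add)
  moreover have "(c n)\<^sup>2 * (d $ b * (lp_deriv q (u n) d $ a - lp_deriv q u0 d $ a))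
     + c n * (d $ b * lp_deriv q (u n) (r n) $ a) + c n * (r n $ b * lp_deriv q (u n) d $ a)
     + r n $ b * lp_deriv q (u n) (r n) $ a
     = lp_tensor q (u n) (c n *\<^sub>R d + r n) a b - (c n)\<^sup>2 * lp_tensor q u0 d a b" for n
    by (simp add: lp_tensor_def lp_deriv_add lp_deriv_scaleR power2_eq_square algebra_simps)
  ultimately show ?thesis by simp
qed

section \<open>Expansion of the form into scalar integrals\<close>

definition lp_form :: "real \<Rightarrow> ('n \<Rightarrow> real ^ 'n \<Rightarrow> real ^ 'm ^ 'm) \<Rightarrow> (real ^ 'n) set \<Rightarrow>
     (real ^ 'n \<Rightarrow> real ^ 'm) \<Rightarrow> real" where
  "lp_form q A \<Omega> U = (LINT x:\<Omega>|lebesgue.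
     (\<Sum>j\<in>UNIV. (A j x *v partial_deriv j U x) \<bullet> lp_deriv q (U x) (partial_deriv j U x)))"

lemma matrix_lp_deriv_inner:
  fixes M :: "real ^ 'm ^ 'm"
  shows "(M *v d) \<bullet> lp_deriv q u d = (\<Sum>a\<in>UNIV. \<Sum>b\<in>UNIV. M $ a $ b * lp_tensor q u d a b)"
  by (simp add: inner_vec_def matrix_vector_mult_def lp_tensor_def sum_distrib_left sum_distrib_right mult_ac)

lemma lp_tensor_bounded_on:
  fixes U :: "real ^ 'n \<Rightarrow> real ^ 'm"
  assumes q: "2 \<le> q" and U: "C1_fun U" and K: "compact K"
  obtains C where "\<And>x. x \<in> K \<Longrightarrow> \<bar>lp_tensor q (U x) (partial_deriv j U x) a b\<bar> \<le> C"
proof -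
  have "\<exists>C. \<forall>x\<in>K. norm (f x) \<le> C" if "continuous_on UNIV f" for f :: "real ^ 'n \<Rightarrow> real ^ 'm"
    using compact_imp_bounded[OF compact_continuous_image[OF continuous_on_subset[OF that] K]]
    by (auto simp: bounded_iff)
  then obtain C1 C2 where C: "\<And>x. x \<in> K \<Longrightarrow> norm (U x) \<le> C1" "\<And>x. x \<in> K \<Longrightarrow> norm (partial_deriv j U x) \<le> C2"
    using C1_fun_continuous[OF U] C1_fun_continuous_partial[OF U] by metis
  show thesis
  proof (rule that)
    fix x assume x: "x \<in> K"
    show "\<bar>lp_tensor q (U x) (partial_deriv j U x) a b\<bar> \<le> (q - 1) * C1 powr (q - 2) * C2\<^sup>2"
      using q C[OF x]
      by (intro order.trans[OF abs_lp_tensor_le] mult_mono powr_mono2 power_mono) auto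
  qed
qed

text \<open>Since \<open>lp_tensor\<close> vanishes with \<open>U\<close>, integration over
  \<open>\<Omega>\<close> reduces to integration over \<open>K\<close>, where the matrix entries are
  integrable and the tensor is bounded. This integrability allows the splitting into a sum.\<close>

lemma lp_form_expand:
  fixes U :: "real ^ 'n \<Rightarrow> real ^ 'm"
  assumes q: "2 \<le> q" and A: "\<And>j a b. (\<lambda>x. A j x $ a $ b) locally_integrable_on \<Omega>"
    and K: "compact K" "K \<subseteq> \<Omega>" and U: "C1_fun U" "\<And>x. x \<notin> K \<Longrightarrow> U x = 0"
  shows "lp_form q A \<Omega> U = (\<Sum>j\<in>UNIV. \<Sum>a\<in>UNIV. \<Sum>b\<in>UNIV.
      (LINT x|lebesgue. (indicator K x * A j x $ a $ b) * lp_tensor q (U x) (partial_deriv j U x) a b))"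
    and "integrable lebesgue (\<lambda>x. (indicator K x * A j x $ a $ b) * lp_tensor q (U x) (partial_deriv j U x) a b)"
proof -
  let ?F = "\<lambda>j a b x. (indicator K x * A j x $ a $ b) * lp_tensor q (U x) (partial_deriv j U x) a b"
  show int: "integrable lebesgue (?F j a b)" for j a b
  proof -
    obtain C where "\<And>x. x \<in> K \<Longrightarrow> \<bar>lp_tensor q (U x) (partial_deriv j U x) a b\<bar> \<le> C"
      using lp_tensor_bounded_on[OF q U(1) K(1)] by blast
    then show ?thesis
      by (intro integrable_mult_bounded locally_integrable_on_indicator[OF A K]
          borel_measurable_lp_tensor C1_fun_continuous C1_fun_continuous_partial U)
        (auto simp: indicator_def split: if_splits)
  qed
  have "indicator \<Omega> x *\<^sub>R (\<Sum>j\<in>UNIV. (A j x *v partial_deriv j U x) \<bullet> lp_deriv q (U x) (partial_deriv j U x))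
      = (\<Sum>j\<in>UNIV. \<Sum>a\<in>UNIV. \<Sum>b\<in>UNIV. ?F j a b x)" for x
    using K(2) U(2)[of x]
    by (cases "x \<in> K") (auto simp: matrix_lp_deriv_inner lp_tensor_0)
  then have "lp_form q A \<Omega> U = (LINT x|lebesgue. (\<Sum>j\<in>UNIV. \<Sum>a\<in>UNIV. \<Sum>b\<in>UNIV. ?F j a b x))"
    unfolding lp_form_def set_lebesgue_integral_def by simp
  also have "\<dots> = (\<Sum>j\<in>UNIV. \<Sum>a\<in>UNIV. \<Sum>b\<in>UNIV. (LINT x|lebesgue. ?F j a b x))"
    by (simp add: Bochner_Integration.integral_sum int)
  finally show "lp_form q A \<Omega> U = (\<Sum>j\<in>UNIV. \<Sum>a\<in>UNIV. \<Sum>b\<in>UNIV. (LINT x|lebesgue. ?F j a b x))" .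
qed

text \<open>With amplitude \<open>\<epsilon>\<close> and frequency 1/\<epsilon>^2, the values tend
  to \<open>\<phi> x *\<^sub>R w\<close>, while the derivative in direction \<open>h\<close> is of
  order 1/\<epsilon>.\<close>

definition oscillation :: "(real ^ 'n \<Rightarrow> real) \<Rightarrow> real ^ 'm \<Rightarrow> real ^ 'm \<Rightarrow> 'n \<Rightarrow> real \<Rightarrow> (real \<Rightarrow> real) \<Rightarrow>
    real ^ 'n \<Rightarrow> real ^ 'm" where
  "oscillation \<phi> w \<xi> h \<epsilon> g x = \<phi> x *\<^sub>R (w + (\<epsilon> * g (x $ h / \<epsilon>\<^sup>2)) *\<^sub>R \<xi>)"

text \<open>Amplitude and frequency combine to 1/\<epsilon>, so multiplication by
  \<open>\<epsilon>\<close> leaves a bounded oscillating term in direction \<open>h\<close> and a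
  remainder of order \<epsilon>.\<close>

lemma
  fixes \<phi> :: "real ^ 'n \<Rightarrow> real"
  assumes \<phi>: "C1_fun \<phi>" and g: "\<And>s. (g has_real_derivative g' s) (at s)" "continuous_on UNIV g'"
  shows C1_fun_oscillation: "C1_fun (oscillation \<phi> w \<xi> h \<epsilon> g)"
    and partial_deriv_oscillation: "0 < \<epsilon> \<Longrightarrow> \<epsilon> *\<^sub>R partial_deriv j (oscillation \<phi> w \<xi> h \<epsilon> g) x =
      (if j = h then g' (x $ h / \<epsilon>\<^sup>2) else 0) *\<^sub>R (\<phi> x *\<^sub>R \<xi>)
        + (\<epsilon> * partial_deriv j \<phi> x) *\<^sub>R (w + (\<epsilon> * g (x $ h / \<epsilon>\<^sup>2)) *\<^sub>R \<xi>)"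
proof -
  let ?l = "\<lambda>x :: real ^ 'n. x $ h / \<epsilon>\<^sup>2"
  have l: "bounded_linear ?l"
    by (intro bounded_linear_compose[OF bounded_linear_divide bounded_linear_vec_nth])
  note Cl = C1_fun_bounded_linear[OF l]
  have pl: "partial_deriv j ?l x = (if j = h then 1 / \<epsilon>\<^sup>2 else 0)" for x
    using partial_deriv_has_derivative[OF bounded_linear_imp_has_derivative[OF l], of j x]
    by (simp add: axis_def)
  have eg: "((\<lambda>s. \<epsilon> * g s) has_real_derivative \<epsilon> * g' s) (at s)" for s
    by (auto intro!: derivative_eq_intros g)
  have ceg: "continuous_on UNIV (\<lambda>s. \<epsilon> * g' s)" by (intro continuous_intros g)
  note Cg = C1_fun_compose_real[OF eg Cl ceg]
  note Cw = C1_fun_add[OF C1_fun_const C1_fun_scaleR[OF Cg C1_fun_const]]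
  show "C1_fun (oscillation \<phi> w \<xi> h \<epsilon> g)"
    unfolding oscillation_def by (intro C1_fun_scaleR \<phi> Cw)
  assume e: "0 < \<epsilon>"
  have "partial_deriv j (oscillation \<phi> w \<xi> h \<epsilon> g) x =
     \<phi> x *\<^sub>R ((\<epsilon> * g' (?l x)) * (if j = h then 1 / \<epsilon>\<^sup>2 else 0)) *\<^sub>R \<xi>
      + partial_deriv j \<phi> x *\<^sub>R (w + (\<epsilon> * g (?l x)) *\<^sub>R \<xi>)"
    unfolding oscillation_def
    by (simp add: partial_deriv_scaleR[OF \<phi> Cw] partial_deriv_add[OF C1_fun_const C1_fun_scaleR[OF Cg C1_fun_const]]
        partial_deriv_scaleR[OF Cg C1_fun_const] partial_deriv_const partial_deriv_compose_real[OF eg Cl] pl)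
  then show "\<epsilon> *\<^sub>R partial_deriv j (oscillation \<phi> w \<xi> h \<epsilon> g) x =
      (if j = h then g' (x $ h / \<epsilon>\<^sup>2) else 0) *\<^sub>R (\<phi> x *\<^sub>R \<xi>)
        + (\<epsilon> * partial_deriv j \<phi> x) *\<^sub>R (w + (\<epsilon> * g (x $ h / \<epsilon>\<^sup>2)) *\<^sub>R \<xi>)"
    using e by (simp add: scaleR_add_right power2_eq_square mult_ac)
qed

text \<open>The values of \<open>g'\<close> are the bounded factor of the limit lemma, and the
  derivative of \<open>\<phi>\<close> enters the remainder. For \<open>j \<noteq> h\<close> the
  factor is 0, so the other directions drop out.\<close>

lemma lp_tensor_oscillation_tendsto:
  fixes \<phi> :: "real ^ 'n \<Rightarrow> real"
  assumes \<phi>: "C1_fun \<phi>" and g: "\<And>s. (g has_real_derivative g' s) (at s)" "continuous_on UNIV g'"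
    and b: "\<And>s. \<bar>g s\<bar> \<le> 1" "\<And>s. \<bar>g' s\<bar> \<le> 1" and w: "w \<noteq> 0" and nz: "\<phi> x \<noteq> 0"
    and \<epsilon>: "\<epsilon> \<longlonglongrightarrow> 0" "\<And>n. 0 < \<epsilon> n"
  shows "(\<lambda>n. lp_tensor q (oscillation \<phi> w \<xi> h (\<epsilon> n) g x)
         (\<epsilon> n *\<^sub>R partial_deriv j (oscillation \<phi> w \<xi> h (\<epsilon> n) g) x) a b
      - (if j = h then g' (x $ h / (\<epsilon> n)\<^sup>2) else 0)\<^sup>2 * lp_tensor q (\<phi> x *\<^sub>R w) (\<phi> x *\<^sub>R \<xi>) a b) \<longlonglongrightarrow> 0"
  unfolding partial_deriv_oscillation[OF \<phi> g \<epsilon>(2)]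
proof (rule lp_tensor_oscillation_limit)
  have "(\<lambda>n. g (x $ h / (\<epsilon> n)\<^sup>2) * \<epsilon> n) \<longlonglongrightarrow> 0"
    by (rule tendsto_bounded_times_null[OF b(1) \<epsilon>(1)])
  then have v: "(\<lambda>n. w + (\<epsilon> n * g (x $ h / (\<epsilon> n)\<^sup>2)) *\<^sub>R \<xi>) \<longlonglongrightarrow> w + 0 *\<^sub>R \<xi>"
    by (intro tendsto_intros) (simp add: mult.commute)
  then show "(\<lambda>n. oscillation \<phi> w \<xi> h (\<epsilon> n) g x) \<longlonglongrightarrow> \<phi> x *\<^sub>R w"
    unfolding oscillation_def by (auto intro!: tendsto_intros)
  show "\<phi> x *\<^sub>R w \<noteq> 0" using w nz by simp
  show "\<bar>if j = h then g' (x $ h / (\<epsilon> n)\<^sup>2) else 0\<bar> \<le> 1" for n using b by auto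
  show "(\<lambda>n. (\<epsilon> n * partial_deriv j \<phi> x) *\<^sub>R (w + (\<epsilon> n * g (x $ h / (\<epsilon> n)\<^sup>2)) *\<^sub>R \<xi>)) \<longlonglongrightarrow> 0"
    using tendsto_scaleR[OF tendsto_mult_left_zero[OF \<epsilon>(1), of "partial_deriv j \<phi> x"] v] by simp
qed

text \<open>Uniformity over \<epsilon> in (0, 1] provides the majorant for the passage to the
  limit.\<close>

lemma lp_tensor_oscillation_bounded:
  fixes \<phi> :: "real ^ 'n \<Rightarrow> real"
  assumes q: "2 \<le> q" and \<phi>: "C1_fun \<phi>" and g: "\<And>s. (g has_real_derivative g' s) (at s)" "continuous_on UNIV g'"
    and b: "\<And>s. \<bar>g s\<bar> \<le> 1" "\<And>s. \<bar>g' s\<bar> \<le> 1" and K: "compact K"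
  obtains C where "\<And>x \<epsilon>. x \<in> K \<Longrightarrow> 0 < \<epsilon> \<Longrightarrow> \<epsilon> \<le> 1 \<Longrightarrow>
    \<bar>lp_tensor q (oscillation \<phi> w \<xi> h \<epsilon> g x) (\<epsilon> *\<^sub>R partial_deriv j (oscillation \<phi> w \<xi> h \<epsilon> g) x) a b\<bar> \<le> C"
proof -
  have "\<exists>C. \<forall>x\<in>K. \<bar>f x\<bar> \<le> C" if "continuous_on UNIV f" for f :: "real ^ 'n \<Rightarrow> real"
    using compact_imp_bounded[OF compact_continuous_image[OF continuous_on_subset[OF that] K]]
    by (auto simp: bounded_iff)
  then obtain C1 C2 where C: "\<And>x. x \<in> K \<Longrightarrow> \<bar>\<phi> x\<bar> \<le> C1" "\<And>x. x \<in> K \<Longrightarrow> \<bar>partial_deriv j \<phi> x\<bar> \<le> C2"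
    using C1_fun_continuous[OF \<phi>] C1_fun_continuous_partial[OF \<phi>] by metis
  define D where "D = norm w + norm \<xi>"
  show thesis
  proof (rule that)
    fix x and \<epsilon> :: real assume x: "x \<in> K" and e: "0 < \<epsilon>" "\<epsilon> \<le> 1"
    have C0: "0 \<le> C1" "0 \<le> C2" "0 \<le> D" using C[OF x] by (auto simp: D_def)
    have "\<bar>\<epsilon> * g (x $ h / \<epsilon>\<^sup>2)\<bar> \<le> 1 * 1" unfolding abs_mult using e b by (intro mult_mono) auto
    then have v: "norm (w + (\<epsilon> * g (x $ h / \<epsilon>\<^sup>2)) *\<^sub>R \<xi>) \<le> D"
      unfolding D_def
      by (intro order.trans[OF norm_triangle_ineq] add_mono) (auto intro: mult_left_le_one_le)
    have 1: "norm (oscillation \<phi> w \<xi> h \<epsilon> g x) \<le> C1 * D"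
      unfolding oscillation_def norm_scaleR using C[OF x] v C0 by (intro mult_mono) auto
    have "norm (\<epsilon> *\<^sub>R partial_deriv j (oscillation \<phi> w \<xi> h \<epsilon> g) x) \<le> 1 * (C1 * norm \<xi>) + (1 * C2) * D"
      unfolding partial_deriv_oscillation[OF \<phi> g e(1)]
    proof (intro order.trans[OF norm_triangle_ineq] add_mono)
      show "norm ((if j = h then g' (x $ h / \<epsilon>\<^sup>2) else 0) *\<^sub>R \<phi> x *\<^sub>R \<xi>) \<le> 1 * (C1 * norm \<xi>)"
        unfolding norm_scaleR using C[OF x] C0 b by (intro mult_mono) auto
      show "norm ((\<epsilon> * partial_deriv j \<phi> x) *\<^sub>R (w + (\<epsilon> * g (x $ h / \<epsilon>\<^sup>2)) *\<^sub>R \<xi>)) \<le> (1 * C2) * D"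
        unfolding norm_scaleR abs_mult using C[OF x] C0 e v by (intro mult_mono) auto
    qed
    with 1 show "\<bar>lp_tensor q (oscillation \<phi> w \<xi> h \<epsilon> g x) (\<epsilon> *\<^sub>R partial_deriv j (oscillation \<phi> w \<xi> h \<epsilon> g) x) a b\<bar>
        \<le> (q - 1) * (C1 * D) powr (q - 2) * (1 * (C1 * norm \<xi>) + (1 * C2) * D)\<^sup>2"
      using q by (intro order.trans[OF abs_lp_tensor_le] mult_mono powr_mono2 power_mono) auto
  qed
qed

section \<open>Localisation and the equivalence\<close>

text \<open>The degree is q - 2 in the first vector and 2 in the direction. This extracts |\<phi>|^q
  from the limit integrand, which then involves only the constant vectors \<open>w\<close> and
  \<open>\<xi>\<close>.\<close>

lemma lp_tensor_homogeneous:
  assumes "c \<noteq> 0"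
  shows "lp_tensor q (c *\<^sub>R w) (c *\<^sub>R \<xi>) a b = \<bar>c\<bar> powr q * lp_tensor q w \<xi> a b"
proof -
  have "\<bar>c\<bar> powr q = c\<^sup>2 * \<bar>c\<bar> powr (q - 2)"
    using assms powr_add[of "\<bar>c\<bar>" 2 "q - 2"] by simp
  then show ?thesis
    using assms by (simp add: lp_tensor_def lp_deriv_scaleR lp_deriv_homogeneous power2_eq_square)
qed

text \<open>The form is quadratic in the derivative, so \<open>\<epsilon>\<^sup>2\<close> is
  absorbed by rescaling the derivative.\<close>

lemma scaled_lp_form_expand:
  fixes U :: "real ^ 'n \<Rightarrow> real ^ 'm"
  assumes q: "2 \<le> q" and A: "\<And>j a b. (\<lambda>x. A j x $ a $ b) locally_integrable_on \<Omega>"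
    and K: "compact K" "K \<subseteq> \<Omega>" and U: "C1_fun U" "\<And>x. x \<notin> K \<Longrightarrow> U x = 0"
  shows "\<epsilon>\<^sup>2 * lp_form q A \<Omega> U = (\<Sum>j\<in>UNIV. \<Sum>a\<in>UNIV. \<Sum>b\<in>UNIV.
      (LINT x|lebesgue. (indicator K x * A j x $ a $ b) * lp_tensor q (U x) (\<epsilon> *\<^sub>R partial_deriv j U x) a b))"
    and "integrable lebesgue (\<lambda>x. (indicator K x * A j x $ a $ b) * lp_tensor q (U x) (\<epsilon> *\<^sub>R partial_deriv j U x) a b)"
proof -
  have eq: "(\<lambda>x. (indicator K x * A j x $ a $ b) * lp_tensor q (U x) (\<epsilon> *\<^sub>R partial_deriv j U x) a b)
      = (\<lambda>x. \<epsilon>\<^sup>2 * ((indicator K x * A j x $ a $ b) * lp_tensor q (U x) (partial_deriv j U x) a b))" for j a b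
    by (simp add: lp_tensor_scaleR mult_ac)
  show "\<epsilon>\<^sup>2 * lp_form q A \<Omega> U = (\<Sum>j\<in>UNIV. \<Sum>a\<in>UNIV. \<Sum>b\<in>UNIV.
      (LINT x|lebesgue. (indicator K x * A j x $ a $ b) * lp_tensor q (U x) (\<epsilon> *\<^sub>R partial_deriv j U x) a b))"
    unfolding eq integral_mult_right_zero by (simp add: lp_form_expand(1)[OF q A K U] sum_distrib_left)
  show "integrable lebesgue (\<lambda>x. (indicator K x * A j x $ a $ b) * lp_tensor q (U x) (\<epsilon> *\<^sub>R partial_deriv j U x) a b)"
    unfolding eq by (intro integrable_mult_right lp_form_expand(2)[OF q A K U])
qed

text \<open>The oscillations with profiles \<open>sin\<close> and \<open>cos\<close> are used in a pair, because
  \<open>sin\<^sup>2 + cos\<^sup>2 = 1\<close> makes the sum of the rescaled integrands converge pointwise.\<close>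

lemma test_integral_nonneg:
  fixes \<Omega> :: "(real ^ 'n) set" and A :: "'n \<Rightarrow> real ^ 'n \<Rightarrow> real ^ 'm ^ 'm"
  assumes q: "2 \<le> q" and A: "\<And>j a b. (\<lambda>x. A j x $ a $ b) locally_integrable_on \<Omega>"
    and diss: "\<And>U K. C1_fun U \<Longrightarrow> compact K \<Longrightarrow> K \<subseteq> \<Omega> \<Longrightarrow> (\<And>x. x \<notin> K \<Longrightarrow> U x = 0) \<Longrightarrow> 0 \<le> lp_form q A \<Omega> U"
    and K: "compact K" "K \<subseteq> \<Omega>" and \<phi>: "C1_fun \<phi>" "\<And>x. x \<notin> K \<Longrightarrow> \<phi> x = 0"
    and w: "w \<noteq> 0"
  shows "0 \<le> (LINT x|lebesgue. (indicator K x * ((A h x *v \<xi>) \<bullet> lp_deriv q w \<xi>)) * \<bar>\<phi> x\<bar> powr q)"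
proof -
  define \<epsilon> where "\<epsilon> = (\<lambda>n. inverse (real (Suc n)))"
  have \<epsilon>: "\<epsilon> \<longlonglongrightarrow> 0" "\<And>n. 0 < \<epsilon> n" "\<And>n. \<epsilon> n \<le> 1"
    unfolding \<epsilon>_def by (rule LIMSEQ_inverse_real_of_nat) (auto simp: field_simps)
  let ?B = "\<lambda>j a b x. indicator K x * A j x $ a $ b"
  let ?U = "\<lambda>g n. oscillation \<phi> w \<xi> h (\<epsilon> n) g"
  let ?F = "\<lambda>g j a b n x. lp_tensor q (?U g n x) (\<epsilon> n *\<^sub>R partial_deriv j (?U g n) x) a b"
  let ?G = "\<lambda>j a b n x. ?F sin j a b n x + ?F cos j a b n x"
  let ?L = "\<lambda>j a b x. (if j = h then \<bar>\<phi> x\<bar> powr q * lp_tensor q w \<xi> a b else 0)"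
  have dc: "(cos has_real_derivative - sin s) (at s)" for s :: real by (rule DERIV_cos)
  have cs: "continuous_on UNIV (cos :: real \<Rightarrow> real)" "continuous_on UNIV (\<lambda>s :: real. - sin s)"
    by (intro continuous_intros)+
  have bs: "\<bar>sin s\<bar> \<le> 1" "\<bar>cos s\<bar> \<le> 1" "\<bar>- sin s\<bar> \<le> 1" for s :: real by simp_all
  have CU: "C1_fun (?U sin n)" "C1_fun (?U cos n)" for n
    using C1_fun_oscillation[OF \<phi>(1) DERIV_sin cs(1)] C1_fun_oscillation[OF \<phi>(1) dc cs(2)] by blast+
  have U0: "?U g n x = 0" if "x \<notin> K" for g n x
    using \<phi>(2)[OF that] by (simp add: oscillation_def)
  have cF: "continuous_on UNIV (\<lambda>x. \<epsilon> n *\<^sub>R partial_deriv j (?U sin n) x)"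
      "continuous_on UNIV (\<lambda>x. \<epsilon> n *\<^sub>R partial_deriv j (?U cos n) x)" for j n
    by (intro continuous_intros C1_fun_continuous_partial CU)+
  have mF: "?F sin j a b n \<in> borel_measurable lebesgue" "?F cos j a b n \<in> borel_measurable lebesgue" for j a b n
    by (intro borel_measurable_lp_tensor C1_fun_continuous CU cF)+
  have c\<phi>: "continuous_on UNIV (\<lambda>x. \<bar>\<phi> x\<bar>)" by (intro continuous_intros C1_fun_continuous \<phi>)
  have m\<phi>[measurable]: "(\<lambda>x. \<bar>\<phi> x\<bar>) \<in> borel_measurable lebesgue"
    by (rule borel_measurable_lebesgue_continuous[OF c\<phi>])
  have mL: "?L j a b \<in> borel_measurable lebesgue" for j a b by measurable
  have lim: "(\<lambda>n. ?G j a b n x) \<longlonglongrightarrow> ?L j a b x" for j a b x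
  proof (cases "\<phi> x = 0")
    \<comment> \<open>The limit lemma covers \<open>\<phi> x \<noteq> 0\<close>; here the
      oscillations vanish at \<open>x\<close> and both sides are 0.\<close>
    case True
    then show ?thesis by (simp add: oscillation_def lp_tensor_0)
  next
    case False
    from tendsto_add[OF lp_tensor_oscillation_tendsto[OF \<phi>(1) DERIV_sin cs(1) bs(1,2) w False \<epsilon>(1,2), where h = h and q = q and \<xi> = \<xi> and j = j and a = a and b = b]
        lp_tensor_oscillation_tendsto[OF \<phi>(1) dc cs(2) bs(2,3) w False \<epsilon>(1,2), where h = h and q = q and \<xi> = \<xi> and j = j and a = a and b = b]]
    have *: "(\<lambda>n. ?F sin j a b n x - (if j = h then cos (x $ h / (\<epsilon> n)\<^sup>2) else 0)\<^sup>2 * lp_tensor q (\<phi> x *\<^sub>R w) (\<phi> x *\<^sub>R \<xi>) a b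
       + (?F cos j a b n x - (if j = h then - sin (x $ h / (\<epsilon> n)\<^sup>2) else 0)\<^sup>2 * lp_tensor q (\<phi> x *\<^sub>R w) (\<phi> x *\<^sub>R \<xi>) a b))
       \<longlonglongrightarrow> 0" by simp
    have "?F sin j a b n x - (if j = h then cos (x $ h / (\<epsilon> n)\<^sup>2) else 0)\<^sup>2 * lp_tensor q (\<phi> x *\<^sub>R w) (\<phi> x *\<^sub>R \<xi>) a b
       + (?F cos j a b n x - (if j = h then - sin (x $ h / (\<epsilon> n)\<^sup>2) else 0)\<^sup>2 * lp_tensor q (\<phi> x *\<^sub>R w) (\<phi> x *\<^sub>R \<xi>) a b)
       = ?G j a b n x - ?L j a b x" for n
    proof -
      have "(cos t)\<^sup>2 * z + (sin t)\<^sup>2 * z = z" for t z :: real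
        by (simp flip: distrib_right)
      from this[of "x $ h / (\<epsilon> n)\<^sup>2" "lp_tensor q (\<phi> x *\<^sub>R w) (\<phi> x *\<^sub>R \<xi>) a b"] show ?thesis
        unfolding lp_tensor_homogeneous[OF False] by (auto simp del: sin_squared_eq)
    qed
    with * have "(\<lambda>n. ?G j a b n x - ?L j a b x) \<longlonglongrightarrow> 0" by simp
    then show ?thesis by (rule LIM_zero_cancel)
  qed
  have conv: "(\<lambda>n. LINT x|lebesgue. ?B j a b x * ?G j a b n x) \<longlonglongrightarrow> (LINT x|lebesgue. ?B j a b x * ?L j a b x)" for j a b
  proof -
    obtain C1 where C1: "\<And>x e. x \<in> K \<Longrightarrow> 0 < e \<Longrightarrow> e \<le> 1 \<Longrightarrow>
      \<bar>lp_tensor q (oscillation \<phi> w \<xi> h e sin x) (e *\<^sub>R partial_deriv j (oscillation \<phi> w \<xi> h e sin) x) a b\<bar> \<le> C1"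
      using lp_tensor_oscillation_bounded[OF q \<phi>(1) DERIV_sin cs(1) bs(1,2) K(1)] by metis
    obtain C2 where C2: "\<And>x e. x \<in> K \<Longrightarrow> 0 < e \<Longrightarrow> e \<le> 1 \<Longrightarrow>
      \<bar>lp_tensor q (oscillation \<phi> w \<xi> h e cos x) (e *\<^sub>R partial_deriv j (oscillation \<phi> w \<xi> h e cos) x) a b\<bar> \<le> C2"
      using lp_tensor_oscillation_bounded[OF q \<phi>(1) dc cs(2) bs(2,3) K(1)] by metis
    show ?thesis
    \<comment> \<open>\<open>?B\<close> vanishes off \<open>K\<close>, so the bounds on
      \<open>K\<close> give a constant majorant for \<open>?G\<close>.\<close>
    proof (rule tendsto_integral_mult_bounded[OF locally_integrable_on_indicator[OF A K] _ mL _ lim])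
      show "?G j a b n \<in> borel_measurable lebesgue" for n by (intro borel_measurable_add mF)
      show "\<bar>?G j a b n x\<bar> \<le> C1 + C2" if "?B j a b x \<noteq> 0" for n x
        using that C1[OF _ \<epsilon>(2,3), of x n] C2[OF _ \<epsilon>(2,3), of x n]
        by (intro order.trans[OF abs_triangle_ineq] add_mono) (auto simp: indicator_def split: if_splits)
    qed
  qed
  note E = scaled_lp_form_expand[OF q A K CU(1)] scaled_lp_form_expand[OF q A K CU(2)]
  have "(LINT x|lebesgue. ?B j a b x * ?G j a b n x)
      = (LINT x|lebesgue. ?B j a b x * ?F sin j a b n x) + (LINT x|lebesgue. ?B j a b x * ?F cos j a b n x)" for j a b n
    unfolding distrib_left
    by (rule Bochner_Integration.integral_add; (rule E(2) | rule E(4)); erule U0)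
  then have "(\<epsilon> n)\<^sup>2 * lp_form q A \<Omega> (?U sin n) + (\<epsilon> n)\<^sup>2 * lp_form q A \<Omega> (?U cos n)
      = (\<Sum>j\<in>UNIV. \<Sum>a\<in>UNIV. \<Sum>b\<in>UNIV. LINT x|lebesgue. ?B j a b x * ?G j a b n x)" for n
    by (simp add: E(1,3) U0 sum.distrib)
  \<comment> \<open>Dissipativity for the two oscillations, rescaled before the limit is
    taken.\<close>
  moreover have "0 \<le> (\<epsilon> n)\<^sup>2 * lp_form q A \<Omega> (?U sin n) + (\<epsilon> n)\<^sup>2 * lp_form q A \<Omega> (?U cos n)" for n
    by (intro add_nonneg_nonneg mult_nonneg_nonneg diss[OF CU(1) K U0] diss[OF CU(2) K U0]) auto
  ultimately have "0 \<le> (\<Sum>j\<in>UNIV. \<Sum>a\<in>UNIV. \<Sum>b\<in>UNIV. LINT x|lebesgue. ?B j a b x * ?G j a b n x)" for n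
    by metis
  then have "0 \<le> (\<Sum>j\<in>UNIV. \<Sum>a\<in>UNIV. \<Sum>b\<in>UNIV. LINT x|lebesgue. ?B j a b x * ?L j a b x)"
    by (intro LIMSEQ_le_const[OF tendsto_sum[OF tendsto_sum[OF tendsto_sum[OF conv]]]]) auto
  also have "\<dots> = (\<Sum>j\<in>UNIV. if j = h then \<Sum>a\<in>UNIV. \<Sum>b\<in>UNIV.
      LINT x|lebesgue. ?B h a b x * (\<bar>\<phi> x\<bar> powr q * lp_tensor q w \<xi> a b) else 0)"
    by (intro sum.cong) auto
  also have "\<dots> = (\<Sum>a\<in>UNIV. \<Sum>b\<in>UNIV. LINT x|lebesgue. ?B h a b x * (\<bar>\<phi> x\<bar> powr q * lp_tensor q w \<xi> a b))"
    by simp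
  also have "\<dots> = (LINT x|lebesgue. (\<Sum>a\<in>UNIV. \<Sum>b\<in>UNIV. ?B h a b x * (\<bar>\<phi> x\<bar> powr q * lp_tensor q w \<xi> a b)))"
  proof -
    obtain C where C: "\<And>x. x \<in> K \<Longrightarrow> \<bar>\<phi> x\<bar> \<le> C"
      using compact_imp_bounded[OF compact_continuous_image[OF continuous_on_subset[OF c\<phi>] K(1)]]
      by (auto simp: bounded_iff)
    have "integrable lebesgue (\<lambda>x. ?B h a b x * (\<bar>\<phi> x\<bar> powr q * lp_tensor q w \<xi> a b))" for a b
    proof (rule integrable_mult_bounded[OF locally_integrable_on_indicator[OF A K]])
      show "\<bar>\<bar>\<phi> x\<bar> powr q * lp_tensor q w \<xi> a b\<bar> \<le> C powr q * \<bar>lp_tensor q w \<xi> a b\<bar>"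
        if "?B h a b x \<noteq> 0" for x
        using that q C[of x] by (auto simp: abs_mult indicator_def split: if_splits intro!: mult_right_mono powr_mono2)
    qed measurable
    then show ?thesis by (simp add: Bochner_Integration.integral_sum)
  qed
  also have "\<dots> = (LINT x|lebesgue. (indicator K x * ((A h x *v \<xi>) \<bullet> lp_deriv q w \<xi>)) * \<bar>\<phi> x\<bar> powr q)"
    by (simp add: matrix_lp_deriv_inner sum_distrib_left sum_distrib_right mult_ac)
  finally show ?thesis .
qed

lemma locally_integrable_matrix_form:
  fixes M :: "real ^ 'n \<Rightarrow> real ^ 'm ^ 'm"
  assumes "\<And>a b. (\<lambda>x. M x $ a $ b) locally_integrable_on \<Omega>"
  shows "(\<lambda>x. (M x *v \<xi>) \<bullet> \<eta>) locally_integrable_on \<Omega>"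
  unfolding locally_integrable_on_def
proof (intro allI impI)
  fix K assume K: "compact K" "K \<subseteq> \<Omega>"
  have "integrable lebesgue (\<lambda>x. \<Sum>a\<in>UNIV. \<Sum>b\<in>UNIV. (indicator K x * M x $ a $ b) * (\<xi> $ b * \<eta> $ a))"
    by (intro Bochner_Integration.integrable_sum integrable_mult_left locally_integrable_on_indicator[OF assms K])
  then show "(\<lambda>x. (M x *v \<xi>) \<bullet> \<eta>) absolutely_integrable_on K"
    by (simp add: set_integrable_def inner_vec_def matrix_vector_mult_def sum_distrib_left sum_distrib_right mult_ac)
qed

text \<open>For a fixed pair the sign follows from the test integrals, with an exceptional null set
  that depends on the pair. A countable dense set of pairs leaves a single null set, and continuity
  in the pair covers the rest.\<close>

lemma AE_form_nonneg:
  fixes \<Omega> :: "(real ^ 'n) set" and A :: "'n \<Rightarrow> real ^ 'n \<Rightarrow> real ^ 'm ^ 'm"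
  assumes q: "2 \<le> q" and \<Omega>: "open \<Omega>" and A: "\<And>j a b. (\<lambda>x. A j x $ a $ b) locally_integrable_on \<Omega>"
    and diss: "\<And>U K. C1_fun U \<Longrightarrow> compact K \<Longrightarrow> K \<subseteq> \<Omega> \<Longrightarrow> (\<And>x. x \<notin> K \<Longrightarrow> U x = 0) \<Longrightarrow> 0 \<le> lp_form q A \<Omega> U"
  shows "AE x\<in>\<Omega> in lebesgue. \<forall>w \<xi>. 0 \<le> (norm w)\<^sup>2 * ((A h x *v \<xi>) \<bullet> \<xi>) + (q - 2) * ((w \<bullet> \<xi>) * (w \<bullet> (A h x *v \<xi>)))"
proof -
  let ?Q = "\<lambda>x w \<xi>. (norm w)\<^sup>2 * ((A h x *v \<xi>) \<bullet> \<xi>) + (q - 2) * ((w \<bullet> \<xi>) * (w \<bullet> (A h x *v \<xi>)))"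
  have "AE x in lebesgue. x \<in> \<Omega> \<longrightarrow> 0 \<le> ?Q x w \<xi>" for w \<xi>
  proof (cases "w = 0")
    case False
    have "AE x\<in>\<Omega> in lebesgue. 0 \<le> (A h x *v \<xi>) \<bullet> lp_deriv q w \<xi>"
      by (rule AE_nonneg_if_test_integrals_nonneg[where q = q])
        (use q \<Omega> False in \<open>auto intro!: locally_integrable_matrix_form A test_integral_nonneg diss\<close>)
    then show ?thesis
      using False by (auto simp: lp_deriv_form zero_le_mult_iff elim!: eventually_mono)
  qed simp
  moreover obtain D :: "((real ^ 'm) \<times> (real ^ 'm)) set" where D: "countable D"
    "\<And>X. open X \<Longrightarrow> X \<noteq> {} \<Longrightarrow> \<exists>d\<in>D. d \<in> X"
    using countable_dense_setE by blast
  ultimately have "AE x in lebesgue. \<forall>z\<in>D. x \<in> \<Omega> \<longrightarrow> 0 \<le> ?Q x (fst z) (snd z)"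
    by (intro AE_ball_countable') auto
  then show ?thesis
  proof eventually_elim
    case (elim x)
    have "continuous_on UNIV (\<lambda>z. ?Q x (fst z) (snd z))"
      by (intro continuous_intros continuous_on_compose2[OF matrix_vector_mult_linear_continuous_on]) auto
    then have "open {z. ?Q x (fst z) (snd z) < 0}"
      by (intro open_Collect_less) auto
    then have "x \<in> \<Omega> \<Longrightarrow> {z. ?Q x (fst z) (snd z) < 0} = {}"
      using D(2) elim by (metis (mono_tags, lifting) linorder_not_less mem_Collect_eq)
    then show ?case by (force simp: not_less)
  qed
qed

section \<open>Real test functions among the complex ones\<close>

definition complex_vec :: "real ^ 'm \<Rightarrow> complex ^ 'm" where
  "complex_vec x = (\<chi> i. complex_of_real (x $ i))"

lemma bounded_linear_complex_vec: "bounded_linear complex_vec"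
  by (rule linear_conv_bounded_linear[THEN iffD1], rule linearI)
    (auto simp: complex_vec_def vec_eq_iff complex_eq_iff)

lemma norm_complex_vec: "norm (complex_vec x) = norm x"
  by (simp add: complex_vec_def norm_vec_def)

lemma herm_prod_complex_vec: "herm_prod (complex_vec x) (complex_vec y) = complex_of_real (x \<bullet> y)"
  by (simp add: herm_prod_def complex_vec_def inner_vec_def)

lemma of_real_matrix_complex_vec:
  "map_matrix complex_of_real M *v complex_vec x = complex_vec (M *v x)"
  by (simp add: complex_vec_def vec_eq_iff matrix_vector_mult_def map_matrix_def)

lemma partial_deriv_complex_vec:
  assumes "((\<lambda>t. U (x + t *\<^sub>R axis h 1)) has_vector_derivative d) (at 0)"
  shows "partial_deriv h (\<lambda>x. complex_vec (U x)) x = complex_vec d"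
  by (intro partial_deriv_eqI bounded_linear.has_vector_derivative[OF bounded_linear_complex_vec assms])

lemma C1_fun_complex_vec:
  assumes U: "C1_fun U"
  shows "C1_fun (\<lambda>x. complex_vec (U x))"
proof -
  have "partial_deriv h (\<lambda>x. complex_vec (U x)) = (\<lambda>x. complex_vec (partial_deriv h U x))" for h
    by (intro ext partial_deriv_complex_vec has_vector_derivative_partial_deriv C1_fun_differentiable U)
  moreover have "(\<lambda>x. complex_vec (U x)) differentiable (at x)" for x
    using bounded_linear.has_derivative[OF bounded_linear_complex_vec] C1_fun_differentiable[OF U, of x]
    by (auto simp: differentiable_def)
  ultimately show ?thesis
    unfolding C1_fun_def
    by (auto intro!: bounded_linear.continuous_on[OF bounded_linear_complex_vec] C1_fun_continuous_partial[OF U])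
qed

text \<open>The assumption \<open>2 < q\<close> makes \<open>lp_deriv\<close> the true derivative
  also at the zeros of \<open>U\<close>. In the swapped form the matrix moves to the other argument
  as its transpose, so the identity holds for every \<open>A\<close>.\<close>

lemma
  fixes A :: "'n \<Rightarrow> real ^ 'n \<Rightarrow> real ^ 'm ^ 'm"
  assumes q: "2 < q" and U: "C1_fun U"
  defines "u \<equiv> \<lambda>x. complex_vec (U x)"
  defines "v \<equiv> \<lambda>x. norm (u x) powr (q - 2) *\<^sub>R u x"
  shows sesq_form_complex_vec: "sesq_form A \<Omega> u v = complex_of_real (lp_form q A \<Omega> U)"
    and sesq_form_complex_vec_swap:
      "sesq_form A \<Omega> v u = complex_of_real (lp_form q (\<lambda>h x. transpose (A h x)) \<Omega> U)"
proof -
  have pu: "partial_deriv h u x = complex_vec (partial_deriv h U x)" for h x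
    unfolding u_def
    by (intro partial_deriv_complex_vec has_vector_derivative_partial_deriv C1_fun_differentiable U)
  have v: "v = (\<lambda>x. complex_vec (norm (U x) powr (q - 2) *\<^sub>R U x))"
    by (simp add: v_def u_def norm_complex_vec linear_scale[OF bounded_linear.linear[OF bounded_linear_complex_vec]])
  have pv: "partial_deriv h v x = complex_vec (lp_deriv q (U x) (partial_deriv h U x))" for h x
    unfolding v
    by (intro partial_deriv_complex_vec partial_deriv_norm_powr_scaleR C1_fun_differentiable U) (use q in auto)
  show "sesq_form A \<Omega> u v = complex_of_real (lp_form q A \<Omega> U)"
    by (simp add: sesq_form_def lp_form_def pu pv of_real_matrix_complex_vec herm_prod_complex_vec
        flip: of_real_sum set_integral_complex_of_real)
  have tr: "(A h x *v y) \<bullet> z = (transpose (A h x) *v z) \<bullet> y" for h x y z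
    by (metis dot_lmul_matrix inner_commute transpose_matrix_vector)
  show "sesq_form A \<Omega> v u = complex_of_real (lp_form q (\<lambda>h x. transpose (A h x)) \<Omega> U)"
    unfolding sesq_form_def lp_form_def pu pv of_real_matrix_complex_vec herm_prod_complex_vec tr
    by (simp flip: of_real_sum set_integral_complex_of_real)
qed

lemma eigenvalue_condition_if_Lp_dissipative:
  fixes \<Omega> :: "(real ^ 'n) set"
    and A :: "'n \<Rightarrow> real ^ 'n \<Rightarrow> real ^ 'm ^ 'm"
  assumes p: "1 < p" and \<Omega>: "open \<Omega>" and A: "\<And>h i j. (\<lambda>x. A h x $ i $ j) locally_integrable_on \<Omega>"
    and sym: "AE x\<in>\<Omega> in lebesgue. \<forall>h. transpose (A h x) = A h x"
    and psd: "AE x\<in>\<Omega> in lebesgue. \<forall>h. \<forall>\<xi> :: real ^ 'm. (A h x *v \<xi>) \<bullet> \<xi> \<ge> 0"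
    and diss: "Lp_dissipative p A \<Omega>"
  shows "AE x\<in>\<Omega> in lebesgue. \<forall>h.
      (1/2 - 1/p)\<^sup>2 * (min_eigenvalue (A h x) + max_eigenvalue (A h x))\<^sup>2
                 \<le> min_eigenvalue (A h x) * max_eigenvalue (A h x)"
proof (cases "p = 2")
  \<comment> \<open>The factor 1/2 - 1/p is 0, and the condition says that a product of nonnegative
    eigenvalues is nonnegative.\<close>
  case True
  show ?thesis
    using sym psd by eventually_elim (auto simp: True intro!: mult_nonneg_nonneg psd_eigenvalues_nonneg)
next
  case False
  define q where "q = (if p \<ge> 2 then p else p / (p - 1))"
  \<comment> \<open>For \<open>p < 2\<close> the weight sits in the first argument, which produces
    the transposed matrices; they agree with \<open>A\<close> almost everywhere in
    \<open>\<Omega>\<close>.\<close>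
  define A' where "A' = (if p \<ge> 2 then A else (\<lambda>h x. transpose (A h x)))"
  have q: "2 < q" using p False by (auto simp: q_def field_simps)
  have eq: "(1/2 - 1/q)\<^sup>2 = (1/2 - 1/p)\<^sup>2"
    using conjugate_exponent_half_diff[OF p] unfolding q_def by (cases "p \<ge> 2") (simp_all only: if_True if_False)
  have "0 \<le> lp_form q A' \<Omega> U"
    if U: "C1_fun U" "compact K" "K \<subseteq> \<Omega>" "\<And>x. x \<notin> K \<Longrightarrow> U x = 0" for U :: "real ^ 'n \<Rightarrow> real ^ 'm" and K
  proof -
    have "(\<lambda>x. complex_vec (U x)) \<in> C1_0 \<Omega>"
      using U(4) by (intro C1_0_I[OF C1_fun_complex_vec[OF U(1)] U(2,3)]) (auto simp: complex_vec_def vec_eq_iff)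
    then show ?thesis
      using diss sesq_form_complex_vec[OF q U(1), of A \<Omega>] sesq_form_complex_vec_swap[OF q U(1), of A \<Omega>]
      unfolding Lp_dissipative_def by (auto simp: q_def A'_def Let_def split: if_splits dest!: bspec)
  qed
  moreover have "(\<lambda>x. A' j x $ a $ b) locally_integrable_on \<Omega>" for j a b
    using A by (auto simp: A'_def transpose_def)
  ultimately have "AE x\<in>\<Omega> in lebesgue. \<forall>w \<xi>. 0 \<le> (norm w)\<^sup>2 * ((A' h x *v \<xi>) \<bullet> \<xi>) + (q - 2) * ((w \<bullet> \<xi>) * (w \<bullet> (A' h x *v \<xi>)))" for h
    using q \<Omega> by (intro AE_form_nonneg) auto
  then have "AE x in lebesgue. \<forall>h. x \<in> \<Omega> \<longrightarrow> (\<forall>w \<xi>. 0 \<le> (norm w)\<^sup>2 * ((A' h x *v \<xi>) \<bullet> \<xi>) + (q - 2) * ((w \<bullet> \<xi>) * (w \<bullet> (A' h x *v \<xi>))))"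
    unfolding AE_all_countable by blast
  then show ?thesis using sym
  proof eventually_elim
    case (elim x)
    show ?case
    proof (intro impI allI)
      fix h assume x: "x \<in> \<Omega>"
      then have s: "transpose (A h x) = A h x" using elim by blast
      then have A': "A' h x = A h x" by (simp add: A'_def)
      have "0 \<le> (norm w)\<^sup>2 * ((A h x *v \<xi>) \<bullet> \<xi>) + (q - 2) * ((w \<bullet> \<xi>) * (w \<bullet> (A h x *v \<xi>)))" for w \<xi>
        using elim(1) x A' by metis
      from eigenvalue_condition_necessary[OF less_imp_le[OF q] s this]
      show "(1/2 - 1/p)\<^sup>2 * (min_eigenvalue (A h x) + max_eigenvalue (A h x))\<^sup>2
                 \<le> min_eigenvalue (A h x) * max_eigenvalue (A h x)"
        unfolding eq .
    qed
  qed
qed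

theorem theorem7:
  fixes \<Omega> :: "(real ^ 'n) set"
    and A :: "'n \<Rightarrow> real ^ 'n \<Rightarrow> real ^ 'm ^ 'm"
    and p :: real
  assumes "is_domain \<Omega>"
    and "1 < p"
    and "\<And>h i j. (\<lambda>x. A h x $ i $ j) locally_integrable_on \<Omega>"
    and "\<And>h. AE x\<in>\<Omega> in lebesgue. transpose (A h x) = A h x"
    and "\<And>h. AE x\<in>\<Omega> in lebesgue. \<forall>\<xi> :: real ^ 'm. (A h x *v \<xi>) \<bullet> \<xi> \<ge> 0"
  shows "(Lp_dissipative p A \<Omega> \<longleftrightarrow>
            (AE x\<in>\<Omega> in lebesgue. \<forall>h.
               (1/2 - 1/p)\<^sup>2 * (min_eigenvalue (A h x) + max_eigenvalue (A h x))\<^sup>2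
                 \<le> min_eigenvalue (A h x) * max_eigenvalue (A h x)))
       \<and> (CARD('m) = 2 \<longrightarrow>
            ((AE x\<in>\<Omega> in lebesgue. \<forall>h.
                (1/2 - 1/p)\<^sup>2 * (min_eigenvalue (A h x) + max_eigenvalue (A h x))\<^sup>2
                  \<le> min_eigenvalue (A h x) * max_eigenvalue (A h x))
             \<longleftrightarrow>
             (AE x\<in>\<Omega> in lebesgue. \<forall>h.
                (1/2 - 1/p)\<^sup>2 * (trace (A h x))\<^sup>2 \<le> det (A h x))))"
proof -
  have \<Omega>: "open \<Omega>" using assms(1) by (simp add: is_domain_def)
  \<comment> \<open>As \<open>h\<close> ranges over a finite type, the null sets for the single
    \<open>h\<close> combine into one.\<close>
  have sym: "AE x\<in>\<Omega> in lebesgue. \<forall>h. transpose (A h x) = A h x"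
    using assms(4) unfolding all_simps(6)[symmetric] AE_all_countable by blast
  have psd: "AE x\<in>\<Omega> in lebesgue. \<forall>h. \<forall>\<xi> :: real ^ 'm. (A h x *v \<xi>) \<bullet> \<xi> \<ge> 0"
    using assms(5) unfolding all_simps(6)[symmetric] AE_all_countable by blast
  show ?thesis
  proof (intro conjI impI iffI)
    assume "Lp_dissipative p A \<Omega>"
    then show "AE x\<in>\<Omega> in lebesgue. \<forall>h.
        (1/2 - 1/p)\<^sup>2 * (min_eigenvalue (A h x) + max_eigenvalue (A h x))\<^sup>2
          \<le> min_eigenvalue (A h x) * max_eigenvalue (A h x)"
      by (rule eigenvalue_condition_if_Lp_dissipative[OF assms(2) \<Omega> assms(3) sym psd])
  next
    assume "AE x\<in>\<Omega> in lebesgue. \<forall>h.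
        (1/2 - 1/p)\<^sup>2 * (min_eigenvalue (A h x) + max_eigenvalue (A h x))\<^sup>2
          \<le> min_eigenvalue (A h x) * max_eigenvalue (A h x)"
    then show "Lp_dissipative p A \<Omega>"
      by (rule Lp_dissipative_if_eigenvalue_condition[OF assms(2) sym psd])
  next
    assume card: "CARD('m) = 2" and "AE x\<in>\<Omega> in lebesgue. \<forall>h.
        (1/2 - 1/p)\<^sup>2 * (min_eigenvalue (A h x) + max_eigenvalue (A h x))\<^sup>2
          \<le> min_eigenvalue (A h x) * max_eigenvalue (A h x)"
    then show "AE x\<in>\<Omega> in lebesgue. \<forall>h. (1/2 - 1/p)\<^sup>2 * (trace (A h x))\<^sup>2 \<le> det (A h x)"
      using sym by eventually_elim (simp add: trace_det_eigenvalues_2[OF card])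
  next
    assume card: "CARD('m) = 2"
      and "AE x\<in>\<Omega> in lebesgue. \<forall>h. (1/2 - 1/p)\<^sup>2 * (trace (A h x))\<^sup>2 \<le> det (A h x)"
    then show "AE x\<in>\<Omega> in lebesgue. \<forall>h.
        (1/2 - 1/p)\<^sup>2 * (min_eigenvalue (A h x) + max_eigenvalue (A h x))\<^sup>2
          \<le> min_eigenvalue (A h x) * max_eigenvalue (A h x)"
      using sym by eventually_elim (simp add: trace_det_eigenvalues_2[OF card])
  qed
qed

end
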